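(* Let $\hat{\mathcal H}^{pe}$ be the Hopf algebra of vf-safe delta-matroids with coproduct $\hat\Delta(D)=\sum_{A\subseteq E}D\backslash A^c\otimes(D+A)/A$, and let $\hat\alpha(\hat{\mathbf a},\hat{\mathbf b})=\exp_*(\hat\delta_{\hat{\mathbf a}})*\exp_*(\hat\delta_{\hat{\mathbf b}})$ with $\hat\delta_{\hat{\mathbf a}}=x_1\delta_c+\sqrt{x_1x_2}\,\delta_o+x_2\delta_n$ and $\hat\delta_{\hat{\mathbf b}}=y_1\delta_c+\sqrt{y_1y_2}\,\delta_o+y_2\delta_n$. Then for every vf-safe delta-matroid $D$ with ground set $E$, $$\hat\alpha(\hat{\mathbf a},\hat{\mathbf b})(D)=x_1^{\xi(D^* )}\,y_2^{|E|-\xi(D^* )}\,\widetilde P_{D^*}\Big(\frac{y_1}{x_1}+1,\frac{x_2}{y_2}+1\Big).$$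
   Context: A delta-matroid $D=(E,\mathcal F)$: finite $E$ and nonempty family $\mathcal F$ of subsets (feasible sets) with: for $X,Y\in\mathcal F$ and $u\in X\triangle Y$ there is $v\in X\triangle Y$ with $X\triangle\{u,v\}\in\mathcal F$. $e$ is a coloop if in every feasible set, a loop if in none. If $e$ is not a coloop, $D\backslash e=(E\setminus e,\{F\in\mathcal F:e\notin F\})$; if $e$ is not a loop, $D/e=(E\setminus e,\{F\setminus e:e\in F\in\mathcal F\})$; if $e$ is a loop or coloop, both equal the one that is defined. Twist $D*A=(E,\{A\triangle X:X\in\mathcal F\})$; dual $D^*=D*E$. Loop complementation $D+e=(E,\mathcal F\triangle\{F\cup e:F\in\mathcal F,e\notin F\})$, $D+A$ applying it to each element of $A$. $D$ is vf-safe if all sequences of twists and loop complementations give delta-matroids. $\hat{\mathcal H}^{pe}$ is the free module (over a field of characteristic 0) spanned by isomorphism classes of vf-safe delta-matroids, graded by $|E|$, multiplication direct sum $(E_1\cup E_2,\{F_1\cup F_2\})$, counit $1$ on the empty delta-matroid and $0$ otherwise. $\delta_c,\delta_o,\delta_n$ are the linear maps equal to $1$ respectively on $(\{e\},\{\{e\}\})$, $(\{e\},\{\emptyset\})$, $(\{e\},\{\emptyset,\{e\}\})$, and $0$ otherwise. $f*g=m\circ(f\otimes g)\circ\Delta$, $\exp_*(\delta)=\sum_{k\ge0}\delta^{*k}/k!$, $\delta^{*0}=\varepsilon$. For a delta-matroid $D'$ on $E$: $r_{\max}(D')$ is the maximum cardinality of a feasible set, $\xi_{D'}(A)=\frac12(|A|+r_{\max}(D'+A)-r_{\max}(D'))$,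 $\xi(D')=\xi_{D'}(E)$, and $\widetilde P_{D'}(x,y)=\sum_{A\subseteq E}(x-1)^{\xi_{D'}(E)-\xi_{D'}(A)}(y-1)^{|A|-\xi_{D'}(A)}$. *)

theory Defs
  imports Complex_Main "HOL-Library.Poly_Mapping"
begin

section \<open>Set systems and delta-matroids\<close>

datatype 'a set_system = Set_System (ground: "'a set") (feasible: "'a set set")

definition delta_matroid :: "'a set_system \<Rightarrow> bool" where
  "delta_matroid D \<longleftrightarrow>
     finite (ground D) \<and> feasible D \<subseteq> Pow (ground D) \<and> feasible D \<noteq> {} \<and>
     (\<forall>X\<in>feasible D. \<forall>Y\<in>feasible D. \<forall>u\<in>sym_diff X Y. \<exists>v\<in>sym_diff X Y.
        sym_diff X {u, v} \<in> feasible D)"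

definition is_loop :: "'a set_system \<Rightarrow> 'a \<Rightarrow> bool" where
  "is_loop D e \<longleftrightarrow> (\<forall>F\<in>feasible D. e \<notin> F)"

definition is_coloop :: "'a set_system \<Rightarrow> 'a \<Rightarrow> bool" where
  "is_coloop D e \<longleftrightarrow> (\<forall>F\<in>feasible D. e \<in> F)"

text \<open>
  Deleting a coloop is, by convention, contracting it, and contracting a loop is deleting it.
\<close>

definition delete :: "'a \<Rightarrow> 'a set_system \<Rightarrow> 'a set_system" where
  "delete e D = Set_System (ground D - {e})
     (if is_coloop D e then {F - {e} | F. F \<in> feasible D \<and> e \<in> F}
      else {F \<in> feasible D. e \<notin> F})"

definition contract :: "'a \<Rightarrow> 'a set_system \<Rightarrow> 'a set_system" where
  "contract e D = Set_System (ground D - {e})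
     (if is_loop D e then {F \<in> feasible D. e \<notin> F}
      else {F - {e} | F. F \<in> feasible D \<and> e \<in> F})"

definition twist :: "'a set \<Rightarrow> 'a set_system \<Rightarrow> 'a set_system" where
  "twist A D = Set_System (ground D) ((\<lambda>X. sym_diff A X) ` feasible D)"

definition dual :: "'a set_system \<Rightarrow> 'a set_system" where
  "dual D = twist (ground D) D"

definition loop_compl :: "'a \<Rightarrow> 'a set_system \<Rightarrow> 'a set_system" where
  "loop_compl e D = Set_System (ground D)
     (sym_diff (feasible D) {insert e F | F. F \<in> feasible D \<and> e \<notin> F})"

text \<open>
  Operations by a finite set \<open>A\<close> are carried out one element at a time, in some enumeration
  of \<open>A\<close>. Loop complementations by different elements always commute; deletions (contractions)
  of different elements commute on delta-matroids.
\<close>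

definition apply_each :: "('a \<Rightarrow> 'a set_system \<Rightarrow> 'a set_system)
    \<Rightarrow> 'a set \<Rightarrow> 'a set_system \<Rightarrow> 'a set_system" where
  "apply_each op A D = fold op (SOME xs. distinct xs \<and> set xs = A) D"

definition delete_set :: "'a set \<Rightarrow> 'a set_system \<Rightarrow> 'a set_system" where
  "delete_set = apply_each delete"

definition contract_set :: "'a set \<Rightarrow> 'a set_system \<Rightarrow> 'a set_system" where
  "contract_set = apply_each contract"

definition loop_compl_set :: "'a set \<Rightarrow> 'a set_system \<Rightarrow> 'a set_system" where
  "loop_compl_set = apply_each loop_compl"

inductive twist_loop_reachable :: "'a set_system \<Rightarrow> 'a set_system \<Rightarrow> bool" for D where
  refl: "twist_loop_reachable D D"
| twist: "twist_loop_reachable D D' \<Longrightarrow> A \<subseteq> ground D' \<Longrightarrow> twist_loop_reachable D (twist A D')"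
| loop_compl: "twist_loop_reachable D D' \<Longrightarrow> e \<in> ground D' \<Longrightarrow>
    twist_loop_reachable D (loop_compl e D')"

definition vf_safe :: "'a set_system \<Rightarrow> bool" where
  "vf_safe D \<longleftrightarrow> (\<forall>D'. twist_loop_reachable D D' \<longrightarrow> delta_matroid D')"


section \<open>The polynomial \<open>P\<close>-tilde\<close>

definition r_max :: "'a set_system \<Rightarrow> nat" where
  "r_max D = Max (card ` feasible D)"

definition xi_on :: "'a set_system \<Rightarrow> 'a set \<Rightarrow> rat" where
  "xi_on D A = (of_nat (card A) + of_nat (r_max (loop_compl_set A D)) - of_nat (r_max D)) / 2"

definition xi :: "'a set_system \<Rightarrow> rat" where
  "xi D = xi_on D (ground D)"

text \<open>
  The numbers \<open>xi_on D A\<close> are half-integers, so the powers below involve square roots.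
  \<open>half_pow z r q\<close> is \<open>z\<close> to the power \<open>q\<close>, for \<open>q\<close> in \<open>(1/2)\<int>\<close>, where \<open>r\<close> is the chosen
  square root of \<open>z\<close>.
\<close>

definition half_pow :: "'k::field \<Rightarrow> 'k \<Rightarrow> rat \<Rightarrow> 'k" where
  "half_pow z r q = (if q \<in> \<int> then z powi \<lfloor>q\<rfloor> else z powi \<lfloor>q\<rfloor> * r)"

lemma half_pow_square:
  assumes "r \<noteq> 0"
  shows "half_pow (r ^ 2) r (of_int m / 2) = r powi m"
proof (cases "even m")
  case True
  then obtain j where "m = 2 * j" by auto
  then show ?thesis by (simp add: half_pow_def power_int_mult)
next
  case False
  then obtain j where m: "m = 2 * j + 1" by (elim oddE)
  have fl: "\<lfloor>(of_int m / 2 :: rat)\<rfloor> = j"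
    by (rule floor_unique) (simp_all add: m)
  have "(of_int m / 2 :: rat) \<notin> \<int>"
  proof
    assume "(of_int m / 2 :: rat) \<in> \<int>"
    then obtain i :: int where "(of_int m / 2 :: rat) = of_int i" by (elim Ints_cases)
    then have "(of_int m :: rat) = of_int (2 * i)" by (simp add: field_simps)
    then have "m = 2 * i" by (simp only: of_int_eq_iff)
    with m show False by presburger
  qed
  then show ?thesis
    using assms by (simp add: half_pow_def fl) (simp add: m power_int_mult power_int_add)
qed

text \<open>
  \<open>P_tilde D x y u v\<close> is the value of the polynomial at \<open>(x, y)\<close>, where \<open>u\<close> and \<open>v\<close> are the
  chosen square roots of \<open>x - 1\<close> and \<open>y - 1\<close>.
\<close>

definition P_tilde :: "'a set_system \<Rightarrow> 'k::field \<Rightarrow> 'k \<Rightarrow> 'k \<Rightarrow> 'k \<Rightarrow> 'k" where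
  "P_tilde D x y u v =
     (\<Sum>A\<in>Pow (ground D). half_pow (x - 1) u (xi_on D (ground D) - xi_on D A)
                         * half_pow (y - 1) v (of_nat (card A) - xi_on D A))"


section \<open>Isomorphism classes of vf-safe delta-matroids\<close>

definition iso :: "'a set_system \<Rightarrow> 'b set_system \<Rightarrow> bool" where
  "iso D D' \<longleftrightarrow>
     (\<exists>f. bij_betw f (ground D) (ground D') \<and> feasible D' = (\<lambda>F. f ` F) ` feasible D)"

text \<open>
  Ground sets are finite, so every isomorphism class has representatives with ground set in
  \<^typ>\<open>nat\<close>; a class is identified with the set of these representatives.
\<close>

definition iso_class :: "'a set_system \<Rightarrow> nat set_system set" where
  "iso_class D = {D'. iso D D'}"

lemma vf_safe_empty: "vf_safe (Set_System {} {{}})"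
proof -
  have "D' = Set_System {} {{}}" if "twist_loop_reachable (Set_System {} {{}}) D'"
    for D' :: "'a set_system"
    using that by induction (auto simp: twist_def)
  moreover have "delta_matroid (Set_System {} {{}})"
    by (simp add: delta_matroid_def)
  ultimately show ?thesis
    unfolding vf_safe_def by metis
qed

typedef dm_class = "{iso_class D | D :: nat set_system. vf_safe D}"
  using vf_safe_empty by blast

text \<open>Meaningful for vf-safe \<open>D\<close> only.\<close>

definition dm_class_of :: "'a set_system \<Rightarrow> dm_class" where
  "dm_class_of D = Abs_dm_class (iso_class D)"

definition dm_rep :: "dm_class \<Rightarrow> nat set_system" where
  "dm_rep C = (SOME D. D \<in> Rep_dm_class C)"


section \<open>The Hopf algebra\<close>

text \<open>
  The free module on a set \<open>B\<close> is the type of finitely supported functions on \<open>B\<close>, and the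
  tensor square of the free module on \<open>B\<close> is the free module on \<open>B \<times> B\<close>.
\<close>

type_synonym 'k hopf = "dm_class \<Rightarrow>\<^sub>0 'k"
type_synonym 'k hopf2 = "(dm_class \<times> dm_class) \<Rightarrow>\<^sub>0 'k"

abbreviation basis :: "'b \<Rightarrow> 'b \<Rightarrow>\<^sub>0 'k::field" where
  "basis b \<equiv> Poly_Mapping.single b 1"

text \<open>Linear extension of a map given on basis elements: scalar-valued and module-valued.\<close>

definition lin_fun :: "('b \<Rightarrow> 'k::field) \<Rightarrow> ('b \<Rightarrow>\<^sub>0 'k) \<Rightarrow> 'k" where
  "lin_fun \<phi> h = (\<Sum>b\<in>Poly_Mapping.keys h. Poly_Mapping.lookup h b * \<phi> b)"

definition lin_map :: "('b \<Rightarrow> 'c \<Rightarrow>\<^sub>0 'k::field) \<Rightarrow> ('b \<Rightarrow>\<^sub>0 'k) \<Rightarrow> ('c \<Rightarrow>\<^sub>0 'k)" where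
  "lin_map \<phi> h =
     (\<Sum>b\<in>Poly_Mapping.keys h. Poly_Mapping.map ((*) (Poly_Mapping.lookup h b)) (\<phi> b))"

definition direct_sum :: "'a set_system \<Rightarrow> 'b set_system \<Rightarrow> ('a + 'b) set_system" where
  "direct_sum D D' = Set_System (ground D <+> ground D')
     {F <+> F' | F F'. F \<in> feasible D \<and> F' \<in> feasible D'}"

definition hmult :: "'k::field hopf2 \<Rightarrow> 'k hopf" where
  "hmult = lin_map (\<lambda>(C, C'). basis (dm_class_of (direct_sum (dm_rep C) (dm_rep C'))))"

definition hunit :: "'k::field hopf" where
  "hunit = basis (dm_class_of (Set_System {} {{}} :: nat set_system))"

definition counit :: "'k::field hopf \<Rightarrow> 'k" where
  "counit = lin_fun (\<lambda>C. if C = dm_class_of (Set_System {} {{}} :: nat set_system) then 1 else 0)"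

definition coproduct :: "'k::field hopf \<Rightarrow> 'k hopf2" where
  "coproduct = lin_map (\<lambda>C. let D = dm_rep C in
     \<Sum>A\<in>Pow (ground D). basis (dm_class_of (delete_set (ground D - A) D),
                               dm_class_of (contract_set A (loop_compl_set A D))))"


section \<open>Convolution of linear functionals\<close>

text \<open>For linear \<open>f\<close> and \<open>g\<close>, \<open>mult_tensor f g\<close> is multiplication of scalars after \<open>f \<otimes> g\<close>.\<close>

definition mult_tensor :: "('k::field hopf \<Rightarrow> 'k) \<Rightarrow> ('k hopf \<Rightarrow> 'k) \<Rightarrow> 'k hopf2 \<Rightarrow> 'k" where
  "mult_tensor f g = lin_fun (\<lambda>(C, C'). f (basis C) * g (basis C'))"

definition conv :: "('k::field hopf \<Rightarrow> 'k) \<Rightarrow> ('k hopf \<Rightarrow> 'k) \<Rightarrow> 'k hopf \<Rightarrow> 'k" where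
  "conv f g = mult_tensor f g \<circ> coproduct"

primrec conv_power :: "('k::field hopf \<Rightarrow> 'k) \<Rightarrow> nat \<Rightarrow> 'k hopf \<Rightarrow> 'k" where
  "conv_power f 0 = counit"
| "conv_power f (Suc k) = conv f (conv_power f k)"

text \<open>
  The series is evaluated pointwise. It is applied to functionals supported in degree 1, for
  which only finitely many terms are nonzero at each \<open>h\<close>; \<^const>\<open>Sum_any\<close> is the sum over
  these.
\<close>

definition exp_conv :: "('k::field_char_0 hopf \<Rightarrow> 'k) \<Rightarrow> 'k hopf \<Rightarrow> 'k" where
  "exp_conv f h = Sum_any (\<lambda>k. conv_power f k h / fact k)"

definition indicator_functional :: "nat set_system \<Rightarrow> 'k::field hopf \<Rightarrow> 'k" where
  "indicator_functional D = lin_fun (\<lambda>C. if C = dm_class_of D then 1 else 0)"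

definition delta_c :: "'k::field hopf \<Rightarrow> 'k" where
  "delta_c = indicator_functional (Set_System {0} {{0}})"

definition delta_o :: "'k::field hopf \<Rightarrow> 'k" where
  "delta_o = indicator_functional (Set_System {0} {{}})"

definition delta_n :: "'k::field hopf \<Rightarrow> 'k" where
  "delta_n = indicator_functional (Set_System {0} {{}, {0}})"

definition delta_hat :: "'k::field \<times> 'k \<times> 'k \<Rightarrow> 'k hopf \<Rightarrow> 'k" where
  "delta_hat = (\<lambda>(c, o', n) h. c * delta_c h + o' * delta_o h + n * delta_n h)"

definition alpha_hat :: "'k::field_char_0 \<times> 'k \<times> 'k \<Rightarrow> 'k \<times> 'k \<times> 'k \<Rightarrow> 'k hopf \<Rightarrow> 'k" where
  "alpha_hat a b = conv (exp_conv (delta_hat a)) (exp_conv (delta_hat b))"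

end

theory Submission
  imports Defs
begin

text \<open>
  Write \<open>d\<close> for the minimum cardinality of a feasible set and \<open>g A\<close> for \<open>d\<close> of the dual pivot of
  \<open>D\<close> on \<open>A\<close>. Deleting an element lowers \<open>d\<close> by one if it is a coloop and does not change \<open>d\<close>
  otherwise, and deletion commutes with dual pivots on other elements. As \<open>(D + A) / A\<close> arises
  from the dual pivot of \<open>D\<close> on \<open>A\<close> by deleting \<open>A\<close>, the difference \<open>g {} - g E\<close> is
  \<open>g {} - g A\<close> for the left factor and \<open>g A - g E\<close> for the right factor of each term of the
  coproduct. Hence the monomial with exponents \<open>card E + g {} - g E\<close> and \<open>card E - g {} + g E\<close> in
  the two square roots is multiplicative along the coproduct, and since it agrees with the
  weights in degree 1 it is the convolution exponential. By duality \<open>g {} - g A\<close> is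
  \<open>2 xi(A) - card A\<close> for the dual of \<open>D\<close>, so the terms of the convolution match those of
  \<open>P_tilde\<close>.
\<close>

section \<open>Dual pivots and minors\<close>

lemma set_system_eqI:
  assumes "ground D = ground D'" and "\<And>F. F \<in> feasible D \<longleftrightarrow> F \<in> feasible D'"
  shows "D = D'"
  using assms by (intro set_system.expand) auto

lemma ground_simps [simp]:
  "ground (twist A D) = ground D" "ground (loop_compl e D) = ground D"
  "ground (dual D) = ground D"
  "ground (delete e D) = ground D - {e}" "ground (contract e D) = ground D - {e}"
  by (simp_all add: twist_def loop_compl_def dual_def delete_def contract_def)

section \<open>Membership criteria for the elementary operations\<close>

lemma mem_twist: "F \<in> feasible (twist A D) \<longleftrightarrow> sym_diff A F \<in> feasible D"
proof -
  have inv: "sym_diff A (sym_diff A X) = X" for X by blast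
  show ?thesis
  proof
    assume "F \<in> feasible (twist A D)"
    then obtain X where "X \<in> feasible D" "F = sym_diff A X" by (auto simp: twist_def)
    then show "sym_diff A F \<in> feasible D" using inv by simp
  next
    assume "sym_diff A F \<in> feasible D"
    then show "F \<in> feasible (twist A D)"
      unfolding twist_def set_system.sel by (rule rev_image_eqI) (rule inv[symmetric])
  qed
qed

text \<open>Inequality of truth values is exclusive or, so this form exposes the cancellation modulo
  2 to case analysis.\<close>

lemma mem_loop_compl:
  "F \<in> feasible (loop_compl e D) \<longleftrightarrow> (F \<in> feasible D) \<noteq> (e \<in> F \<and> F - {e} \<in> feasible D)"
proof -
  have "(\<exists>G. F = insert e G \<and> G \<in> feasible D \<and> e \<notin> G) \<longleftrightarrow> e \<in> F \<and> F - {e} \<in> feasible D"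
  proof
    assume "e \<in> F \<and> F - {e} \<in> feasible D"
    then show "\<exists>G. F = insert e G \<and> G \<in> feasible D \<and> e \<notin> G"
      by (intro exI[of _ "F - {e}"]) auto
  qed auto
  then show ?thesis by (auto simp: loop_compl_def)
qed

lemma mem_remove:
  "(\<exists>G. F = G - {e} \<and> G \<in> S \<and> e \<in> G) \<longleftrightarrow> e \<notin> F \<and> insert e F \<in> S"
proof
  assume "e \<notin> F \<and> insert e F \<in> S"
  then show "\<exists>G. F = G - {e} \<and> G \<in> S \<and> e \<in> G" by (intro exI[of _ "insert e F"]) simp
qed (auto simp: insert_absorb)

lemma mem_delete:
  "F \<in> feasible (delete e D) \<longleftrightarrow>
     e \<notin> F \<and> (if is_coloop D e then insert e F \<in> feasible D else F \<in> feasible D)"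
  using mem_remove[of F e "feasible D"] by (auto simp: delete_def)

lemma mem_contract:
  "F \<in> feasible (contract e D) \<longleftrightarrow>
     e \<notin> F \<and> (if is_loop D e then F \<in> feasible D else insert e F \<in> feasible D)"
  using mem_remove[of F e "feasible D"] by (auto simp: contract_def)

text \<open>
  The dual pivot. If \<open>p\<close> and \<open>q\<close> are the indicator functions modulo 2, on subsets avoiding \<open>e\<close>,
  of the feasible sets avoiding and containing \<open>e\<close>, then it replaces \<open>(p, q)\<close> by \<open>(p + q, q)\<close>,
  whereas loop complementation replaces it by \<open>(p, p + q)\<close> and the twist by \<open>(q, p)\<close>.
\<close>

definition dual_pivot :: "'a \<Rightarrow> 'a set_system \<Rightarrow> 'a set_system" where
  "dual_pivot e D = twist {e} (loop_compl e (twist {e} D))"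

lemma ground_dual_pivot [simp]: "ground (dual_pivot e D) = ground D"
  by (simp add: dual_pivot_def)

lemma mem_dual_pivot:
  "F \<in> feasible (dual_pivot e D) \<longleftrightarrow> (F \<in> feasible D) \<noteq> (e \<notin> F \<and> insert e F \<in> feasible D)"
proof -
  have "sym_diff {e} (sym_diff {e} F) = F" by blast
  moreover have "sym_diff {e} F = F - {e}" "sym_diff {e} (F - {e}) = F" if "e \<in> F" using that by blast+
  moreover have "sym_diff {e} F = insert e F" "sym_diff {e} F - {e} = F" if "e \<notin> F" using that by blast+
  ultimately show ?thesis unfolding dual_pivot_def mem_twist mem_loop_compl
    by (cases "e \<in> F") simp_all
qed

section \<open>Commutation relations between the operations\<close>

lemma loop_compl_commute: "loop_compl e (loop_compl f D) = loop_compl f (loop_compl e D)"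
proof (rule set_system_eqI)
  fix F
  have "F - {e} - {f} = F - {f} - {e}" by blast
  then show "F \<in> feasible (loop_compl e (loop_compl f D)) \<longleftrightarrow>
      F \<in> feasible (loop_compl f (loop_compl e D))"
    by (auto simp: mem_loop_compl)
qed simp

lemma dual_pivot_commute: "dual_pivot e (dual_pivot f D) = dual_pivot f (dual_pivot e D)"
  by (cases "e = f", simp, rule set_system_eqI) (auto simp: mem_dual_pivot insert_commute)

lemma dual_pivot_loop_compl_commute:
  "e \<noteq> f \<Longrightarrow> dual_pivot e (loop_compl f D) = loop_compl f (dual_pivot e D)"
  by (rule set_system_eqI) (auto simp: mem_dual_pivot mem_loop_compl insert_Diff_if)

lemma is_coloop_twist:
  assumes "e \<notin> A" shows "is_coloop (twist A D) e \<longleftrightarrow> is_coloop D e"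
  using assms by (auto simp: is_coloop_def twist_def)

lemma is_coloop_loop_compl:
  assumes "e \<noteq> f" shows "is_coloop (loop_compl f D) e \<longleftrightarrow> is_coloop D e"
proof
  assume *: "is_coloop (loop_compl f D) e"
  show "is_coloop D e" unfolding is_coloop_def
  proof (rule ballI, rule ccontr)
    fix F assume F: "F \<in> feasible D" "e \<notin> F"
    \<comment> \<open>\<open>F\<close> can only be cancelled by \<open>F - {f}\<close>, which then
      survives itself and avoids \<open>e\<close> as well.\<close>
    then have "F \<in> feasible (loop_compl f D) \<or> F - {f} \<in> feasible (loop_compl f D)"
      by (auto simp: mem_loop_compl)
    then show False using * F assms by (auto simp: is_coloop_def)
  qed
qed (use assms in \<open>auto simp: is_coloop_def mem_loop_compl\<close>)

lemma delete_twist: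
  assumes "e \<notin> A" shows "delete e (twist A D) = twist A (delete e D)"
proof -
  have "sym_diff A (insert e F) = insert e (sym_diff A F)" for F using assms by blast
  then show ?thesis
    using assms by (intro set_system_eqI) (auto simp: mem_twist mem_delete is_coloop_twist)
qed

lemma delete_loop_compl:
  assumes "e \<noteq> f" shows "delete e (loop_compl f D) = loop_compl f (delete e D)"
  using assms
  by (intro set_system_eqI) (auto simp: mem_loop_compl mem_delete is_coloop_loop_compl insert_Diff_if)

lemma delete_dual_pivot: "e \<noteq> f \<Longrightarrow> delete e (dual_pivot f D) = dual_pivot f (delete e D)"
  by (simp add: dual_pivot_def delete_twist delete_loop_compl)

lemma is_coloop_dual_pivot: "e \<noteq> f \<Longrightarrow> is_coloop (dual_pivot f D) e \<longleftrightarrow> is_coloop D e"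
  by (simp add: dual_pivot_def is_coloop_twist is_coloop_loop_compl)

text \<open>In terms of \<open>(p, q)\<close>, both sides select \<open>p + q\<close> when it is
  nonzero: it is the part containing \<open>e\<close> after loop complementation and the part
  avoiding \<open>e\<close> after the dual pivot. If it is zero, the loop convention returns
  \<open>p\<close> and the coloop convention returns \<open>q\<close>, and these agree.\<close>

lemma contract_loop_compl: "contract e (loop_compl e D) = delete e (dual_pivot e D)"
proof (rule set_system_eqI)
  have "is_loop (loop_compl e D) e \<longleftrightarrow> (\<forall>F. e \<notin> F \<longrightarrow> (F \<in> feasible D \<longleftrightarrow> insert e F \<in> feasible D))"
    (is "?l = ?m")
  proof
    assume l: ?l
    show ?m
    proof (intro allI impI)
      fix F assume "e \<notin> F"
      then show "F \<in> feasible D \<longleftrightarrow> insert e F \<in> feasible D"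
        using l[unfolded is_loop_def, THEN bspec, of "insert e F"] by (auto simp: mem_loop_compl)
    qed
  next
    assume m: ?m
    show ?l unfolding is_loop_def
    proof
      fix F assume F: "F \<in> feasible (loop_compl e D)"
      show "e \<notin> F"
        using m[rule_format, of "F - {e}"] F by (auto simp: mem_loop_compl insert_absorb)
    qed
  qed
  moreover have m: "is_coloop (dual_pivot e D) e \<longleftrightarrow> ?m"
    unfolding is_coloop_def Ball_def mem_dual_pivot by blast
  ultimately have eq: "is_loop (loop_compl e D) e \<longleftrightarrow> is_coloop (dual_pivot e D) e" by simp
  show "F \<in> feasible (contract e (loop_compl e D)) \<longleftrightarrow> F \<in> feasible (delete e (dual_pivot e D))" for F
  proof (cases "e \<in> F")
    case False
    then have "insert e F - {e} = F" by simp
    moreover have "F \<in> feasible D \<longleftrightarrow> insert e F \<in> feasible D" if "is_coloop (dual_pivot e D) e"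
      using that m False by blast
    ultimately show ?thesis
      using False by (auto simp: mem_contract mem_delete mem_dual_pivot mem_loop_compl eq)
  qed (simp add: mem_contract mem_delete)
qed simp

section \<open>Operations by finite sets of elements\<close>

lemma some_enumeration:
  assumes "finite A" shows "distinct (SOME xs. distinct xs \<and> set xs = A) \<and> set (SOME xs. distinct xs \<and> set xs = A) = A"
  by (rule someI_ex) (use finite_distinct_list[OF assms] in blast)

text \<open>Commutation makes the result independent of the enumeration picked by
  \<open>SOME\<close>: it equals \<open>Finite_Set.fold\<close>, which has the insertion
  rule.\<close>

lemma apply_each_insert:
  assumes commute: "\<And>e f D. op e (op f D) = op f (op e D)" and "finite A" "e \<notin> A"
  shows "apply_each op (insert e A) D = op e (apply_each op A D)"
proof -
  interpret comp_fun_commute op by standard (simp add: commute fun_eq_iff)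
  have eq: "apply_each op B D = Finite_Set.fold op D B" if "finite B" for B
    using some_enumeration[OF that] fold_set_fold_remdups unfolding apply_each_def
    by (metis distinct_remdups_id)
  show ?thesis using assms by (simp add: eq)
qed

lemma apply_each_empty [simp]:
  fixes D :: "'a set_system" shows "apply_each op {} D = D"
  using some_enumeration[of "{} :: 'a set"] by (simp add: apply_each_def)

definition dual_pivot_set :: "'a set \<Rightarrow> 'a set_system \<Rightarrow> 'a set_system" where
  "dual_pivot_set = apply_each dual_pivot"

lemma dual_pivot_set_empty [simp]: "dual_pivot_set {} D = D"
  by (simp add: dual_pivot_set_def)

lemma dual_pivot_set_insert:
  "finite A \<Longrightarrow> e \<notin> A \<Longrightarrow> dual_pivot_set (insert e A) D = dual_pivot e (dual_pivot_set A D)"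
  unfolding dual_pivot_set_def by (rule apply_each_insert) (simp_all add: dual_pivot_commute)

lemma loop_compl_set_empty [simp]: "loop_compl_set {} D = D"
  by (simp add: loop_compl_set_def)

lemma loop_compl_set_insert:
  "finite A \<Longrightarrow> e \<notin> A \<Longrightarrow> loop_compl_set (insert e A) D = loop_compl e (loop_compl_set A D)"
  unfolding loop_compl_set_def by (rule apply_each_insert) (simp_all add: loop_compl_commute)

lemma dual_pivot_dual_pivot_set:
  assumes "finite A" shows "dual_pivot e (dual_pivot_set A D) = dual_pivot_set A (dual_pivot e D)"
  using assms by induction (simp_all add: dual_pivot_set_insert dual_pivot_commute[of e])

lemma dual_pivot_set_Un:
  assumes "finite A" "finite B" "A \<inter> B = {}"
  shows "dual_pivot_set (A \<union> B) D = dual_pivot_set B (dual_pivot_set A D)"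
  using assms(2,3) by induction (simp_all add: dual_pivot_set_insert assms(1))

lemma ground_dual_pivot_set [simp]: "finite A \<Longrightarrow> ground (dual_pivot_set A D) = ground D"
  by (induction rule: finite_induct) (simp_all add: dual_pivot_set_insert)

lemma ground_loop_compl_set [simp]: "finite A \<Longrightarrow> ground (loop_compl_set A D) = ground D"
  by (induction rule: finite_induct) (simp_all add: loop_compl_set_insert)

lemma delete_dual_pivot_set:
  assumes "finite A" "e \<notin> A" shows "delete e (dual_pivot_set A D) = dual_pivot_set A (delete e D)"
  using assms by induction (auto simp: dual_pivot_set_insert delete_dual_pivot)

lemma is_coloop_dual_pivot_set:
  assumes "finite A" "e \<notin> A" shows "is_coloop (dual_pivot_set A D) e \<longleftrightarrow> is_coloop D e"
  using assms by induction (auto simp: dual_pivot_set_insert is_coloop_dual_pivot)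

lemma delete_loop_compl_set:
  assumes "finite A" "e \<notin> A" shows "delete e (loop_compl_set A D) = loop_compl_set A (delete e D)"
  using assms by induction (auto simp: loop_compl_set_insert delete_loop_compl)

lemma dual_pivot_loop_compl_set:
  assumes "finite A" "e \<notin> A" shows "dual_pivot e (loop_compl_set A D) = loop_compl_set A (dual_pivot e D)"
  using assms by induction (auto simp: loop_compl_set_insert dual_pivot_loop_compl_commute)

text \<open>The operations on the tail elements commute past those on the head \<open>e\<close>, so
  \<open>contract_loop_compl\<close> settles the head. The tail is then the induction hypothesis for
  \<open>delete e (dual_pivot e D)\<close>, which is why \<open>D\<close> is generalized.\<close>

lemma fold_contract_loop_compl_set:
  "distinct xs \<Longrightarrow> fold contract xs (loop_compl_set (set xs) D) = fold delete xs (dual_pivot_set (set xs) D)"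
proof (induction xs arbitrary: D)
  case (Cons e xs)
  have "contract e (loop_compl_set (set (e # xs)) D) = loop_compl_set (set xs) (delete e (dual_pivot e D))"
    using Cons.prems
    by (simp add: loop_compl_set_insert contract_loop_compl dual_pivot_loop_compl_set delete_loop_compl_set)
  moreover have "delete e (dual_pivot_set (set (e # xs)) D) = dual_pivot_set (set xs) (delete e (dual_pivot e D))"
    using Cons.prems by (simp add: dual_pivot_set_insert dual_pivot_dual_pivot_set delete_dual_pivot_set)
  ultimately show ?case using Cons by simp
qed simp

text \<open>Contraction and deletion run through the same chosen enumeration of \<open>A\<close>, so
  the identity for lists transfers directly.\<close>

lemma contract_set_loop_compl_set:
  assumes "finite A" shows "contract_set A (loop_compl_set A D) = delete_set A (dual_pivot_set A D)"
  using fold_contract_loop_compl_set some_enumeration[OF assms]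
  unfolding contract_set_def delete_set_def apply_each_def[of contract] apply_each_def[of delete] by metis

text \<open>Deletions need not commute on arbitrary set systems, so \<open>apply_each_insert\<close>
  does not cover them; facts about \<open>delete_set\<close> are reduced to list inductions along
  some enumeration.\<close>

lemma delete_set_fold:
  assumes "finite A"
  obtains xs where "distinct xs" "set xs = A" "delete_set A D = fold delete xs D"
  using some_enumeration[OF assms] unfolding delete_set_def apply_each_def by blast

section \<open>Closure properties of vf-safe delta-matroids\<close>

lemma delta_matroidD:
  assumes "delta_matroid D"
  shows "finite (ground D)" "feasible D \<subseteq> Pow (ground D)" "feasible D \<noteq> {}" "finite (feasible D)"
    "\<And>F. F \<in> feasible D \<Longrightarrow> finite F"
proof -
  show *: "finite (ground D)" "feasible D \<subseteq> Pow (ground D)" "feasible D \<noteq> {}"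
    using assms unfolding delta_matroid_def by simp_all
  show "finite (feasible D)" using * by (meson finite_Pow_iff finite_subset)
  show "finite F" if "F \<in> feasible D" for F using * that by (meson PowD finite_subset subsetD)
qed

lemma delta_matroid_exchange:
  assumes "delta_matroid D" "X \<in> feasible D" "Y \<in> feasible D" "u \<in> sym_diff X Y"
  obtains v where "v \<in> sym_diff X Y" "sym_diff X {u, v} \<in> feasible D"
proof -
  have "\<forall>X\<in>feasible D. \<forall>Y\<in>feasible D. \<forall>u\<in>sym_diff X Y. \<exists>v\<in>sym_diff X Y.
      sym_diff X {u, v} \<in> feasible D"
    using assms(1) unfolding delta_matroid_def by (elim conjE)
  from bspec[OF bspec[OF bspec[OF this assms(2)] assms(3)] assms(4)] that
  show thesis by (elim bexE)
qed

text \<open>Feasible sets of the minor lift to feasible sets of \<open>D\<close> that agree about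
  \<open>e\<close>. Their symmetric difference therefore avoids \<open>e\<close>, and an exchange in
  \<open>D\<close> descends to the minor.\<close>

lemma delta_matroid_delete:
  assumes "delta_matroid D" shows "delta_matroid (delete e D)"
proof -
  note dm = delta_matroidD[OF assms]
  have nonempty: "feasible (delete e D) \<noteq> {}"
  proof (cases "is_coloop D e")
    case True
    obtain F where F: "F \<in> feasible D" using dm(3) by blast
    with True have "insert e (F - {e}) = F" by (auto simp: is_coloop_def)
    then have "F - {e} \<in> feasible (delete e D)" using True F by (simp add: mem_delete)
    then show ?thesis by blast
  next
    case False
    then obtain F where "F \<in> feasible D" "e \<notin> F" by (auto simp: is_coloop_def)
    with False have "F \<in> feasible (delete e D)" by (simp add: mem_delete)
    then show ?thesis by blast
  qed
  have sub: "feasible (delete e D) \<subseteq> Pow (ground D - {e})"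
  proof
    fix F assume "F \<in> feasible (delete e D)"
    then have "e \<notin> F" "insert e F \<in> feasible D \<or> F \<in> feasible D"
      by (auto simp: mem_delete split: if_splits)
    then show "F \<in> Pow (ground D - {e})" using dm(2) by blast
  qed
  have exchange: "\<exists>v\<in>sym_diff X Y. sym_diff X {u, v} \<in> feasible (delete e D)"
    if X: "X \<in> feasible (delete e D)" and Y: "Y \<in> feasible (delete e D)" and u: "u \<in> sym_diff X Y"
    for X Y u
  proof -
    have e: "e \<notin> X" "e \<notin> Y" using X Y by (auto simp: mem_delete)
    show ?thesis
    proof (cases "is_coloop D e")
      case True
      have "insert e X \<in> feasible D" "insert e Y \<in> feasible D" using X Y True by (auto simp: mem_delete)
      moreover have "sym_diff (insert e X) (insert e Y) = sym_diff X Y" using e by blast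
      ultimately obtain v where v: "v \<in> sym_diff X Y" "sym_diff (insert e X) {u, v} \<in> feasible D"
        using delta_matroid_exchange[OF assms, of "insert e X" "insert e Y" u] u by metis
      have "sym_diff (insert e X) {u, v} = insert e (sym_diff X {u, v})" using e u v(1) by blast
      then show ?thesis using v True e u by (auto simp: mem_delete)
    next
      case False
      have "X \<in> feasible D" "Y \<in> feasible D" using X Y False by (auto simp: mem_delete)
      then obtain v where v: "v \<in> sym_diff X Y" "sym_diff X {u, v} \<in> feasible D"
        using delta_matroid_exchange[OF assms] u by metis
      then show ?thesis using False e u by (auto simp: mem_delete)
    qed
  qed
  show ?thesis unfolding delta_matroid_def ground_simps
    by (intro conjI ballI finite_Diff dm(1) sub nonempty exchange)
qed

lemma vf_safe_delta_matroid: "vf_safe D \<Longrightarrow> delta_matroid D"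
  by (auto simp: vf_safe_def intro: twist_loop_reachable.refl)

lemmas vf_safeD = delta_matroidD[OF vf_safe_delta_matroid]

lemma reachable_trans:
  "twist_loop_reachable D' D'' \<Longrightarrow> twist_loop_reachable D D' \<Longrightarrow> twist_loop_reachable D D''"
  by (induction rule: twist_loop_reachable.induct) (auto intro: twist_loop_reachable.intros)

lemma vf_safe_reachable: "vf_safe D \<Longrightarrow> twist_loop_reachable D D' \<Longrightarrow> vf_safe D'"
  unfolding vf_safe_def by (blast intro: reachable_trans)

lemma vf_safe_twist: "vf_safe D \<Longrightarrow> A \<subseteq> ground D \<Longrightarrow> vf_safe (twist A D)"
  by (rule vf_safe_reachable) (auto intro: twist_loop_reachable.intros)

lemma vf_safe_loop_compl: "vf_safe D \<Longrightarrow> e \<in> ground D \<Longrightarrow> vf_safe (loop_compl e D)"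
  by (rule vf_safe_reachable) (auto intro: twist_loop_reachable.intros)

lemma vf_safe_dual_pivot: "vf_safe D \<Longrightarrow> e \<in> ground D \<Longrightarrow> vf_safe (dual_pivot e D)"
  by (simp add: dual_pivot_def vf_safe_twist vf_safe_loop_compl)

lemma vf_safe_dual_pivot_set: "finite A \<Longrightarrow> vf_safe D \<Longrightarrow> A \<subseteq> ground D \<Longrightarrow> vf_safe (dual_pivot_set A D)"
  by (induction rule: finite_induct) (simp_all add: dual_pivot_set_insert vf_safe_dual_pivot)

text \<open>Operations on the minor involve only elements other than \<open>e\<close>, so they
  commute with deleting \<open>e\<close> and every sequence lifts to \<open>D\<close>. This reduces
  vf-safety of minors to \<open>delta_matroid_delete\<close>.\<close>

lemma reachable_delete:
  "twist_loop_reachable (delete e D) D'' \<Longrightarrow> \<exists>D'. twist_loop_reachable D D' \<and> D'' = delete e D'"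
proof (induction rule: twist_loop_reachable.induct)
  case (twist D'' A)
  then obtain D' where D': "twist_loop_reachable D D'" "D'' = delete e D'" by blast
  with twist.hyps(2) have "e \<notin> A" "A \<subseteq> ground D'" by auto
  then have "twist A D'' = delete e (twist A D')" "twist_loop_reachable D (twist A D')"
    using D' by (auto simp: delete_twist intro: twist_loop_reachable.intros)
  then show ?case by blast
next
  case (loop_compl D'' f)
  then obtain D' where D': "twist_loop_reachable D D'" "D'' = delete e D'" by blast
  with loop_compl.hyps(2) have "e \<noteq> f" "f \<in> ground D'" by auto
  then have "loop_compl f D'' = delete e (loop_compl f D')" "twist_loop_reachable D (loop_compl f D')"
    using D' by (auto simp: delete_loop_compl intro: twist_loop_reachable.intros)
  then show ?case by blast
qed (auto intro: twist_loop_reachable.intros)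

lemma vf_safe_delete:
  assumes "vf_safe D" shows "vf_safe (delete e D)"
  unfolding vf_safe_def
proof (intro allI impI)
  fix D'' assume "twist_loop_reachable (delete e D) D''"
  from reachable_delete[OF this] obtain D' where D': "twist_loop_reachable D D'" "D'' = delete e D'"
    by (elim exE conjE)
  then have "delta_matroid D'" using assms by (simp add: vf_safe_def)
  then show "delta_matroid D''" unfolding D'(2) by (rule delta_matroid_delete)
qed

lemma vf_safe_fold_delete: "vf_safe D \<Longrightarrow> vf_safe (fold delete xs D)"
  by (induction xs arbitrary: D) (simp_all add: vf_safe_delete)

lemma ground_fold_delete: "ground (fold delete xs D) = ground D - set xs"
  by (induction xs arbitrary: D) auto

lemma vf_safe_delete_set: "finite A \<Longrightarrow> vf_safe D \<Longrightarrow> vf_safe (delete_set A D)"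
  by (metis delete_set_fold vf_safe_fold_delete)

lemma ground_delete_set: "finite A \<Longrightarrow> ground (delete_set A D) = ground D - A"
  by (metis delete_set_fold ground_fold_delete)

section \<open>Minimal feasible sets and dual pivots\<close>

definition r_min :: "'a set_system \<Rightarrow> nat" where
  "r_min D = Min (card ` feasible D)"

lemma r_min_le: "delta_matroid D \<Longrightarrow> F \<in> feasible D \<Longrightarrow> r_min D \<le> card F"
  by (simp add: r_min_def delta_matroidD)

lemma r_min_attained:
  assumes "delta_matroid D" obtains F where "F \<in> feasible D" "card F = r_min D"
proof -
  have "r_min D \<in> card ` feasible D"
    unfolding r_min_def using assms by (intro Min_in) (auto dest: delta_matroidD)
  then show ?thesis using that by auto
qed

lemma r_min_eqI:
  assumes "delta_matroid D" "F \<in> feasible D" "card F = n" "\<And>G. G \<in> feasible D \<Longrightarrow> n \<le> card G"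
  shows "r_min D = n"
  by (metis assms r_min_attained r_min_le le_antisym)

lemma r_min_delete_coloop:
  assumes "delta_matroid D" "is_coloop D e"
  shows "r_min D = Suc (r_min (delete e D))"
proof -
  obtain F where F: "F \<in> feasible (delete e D)" "card F = r_min (delete e D)"
    using r_min_attained[OF delta_matroid_delete[OF assms(1)]] by blast
  then have F': "insert e F \<in> feasible D" "e \<notin> F" using assms by (auto simp: mem_delete)
  have "finite F" using F delta_matroidD[OF delta_matroid_delete[OF assms(1)]] by blast
  show ?thesis
  proof (rule r_min_eqI[OF assms(1) F'(1)])
    show "card (insert e F) = Suc (r_min (delete e D))" using F F' \<open>finite F\<close> by simp
    fix G assume G: "G \<in> feasible D"
    then have "e \<in> G" using assms by (auto simp: is_coloop_def)
    then have eq: "insert e (G - {e}) = G" by blast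
    then have "G - {e} \<in> feasible (delete e D)" using G assms by (simp add: mem_delete)
    from r_min_le[OF delta_matroid_delete[OF assms(1)] this]
    show "Suc (r_min (delete e D)) \<le> card G"
      using delta_matroidD(5)[OF assms(1) G] eq by (metis Suc_le_mono card_Suc_Diff1 \<open>e \<in> G\<close>)
  qed
qed

text \<open>Exchanging a minimal feasible set containing \<open>e\<close> with a feasible set avoiding \<open>e\<close> must
  trade \<open>e\<close> for another element.\<close>

lemma r_min_delete_not_coloop:
  assumes "delta_matroid D" "\<not> is_coloop D e"
  shows "r_min (delete e D) = r_min D"
proof -
  obtain Y where Y: "Y \<in> feasible D" "e \<notin> Y" using assms by (auto simp: is_coloop_def)
  obtain X where X: "X \<in> feasible D" "card X = r_min D" using r_min_attained[OF assms(1)] by blast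
  note fin = delta_matroidD(5)[OF assms(1)]
  have "\<exists>F. F \<in> feasible D \<and> card F = r_min D \<and> e \<notin> F"
  proof (cases "e \<in> X")
    case True
    then obtain v where v: "v \<in> sym_diff X Y" "sym_diff X {e, v} \<in> feasible D"
      using delta_matroid_exchange[OF assms(1) X(1) Y(1), of e] Y by blast
    \<comment> \<open>As \<open>e \<in> X\<close>, this also excludes \<open>v = e\<close>.
      Otherwise the exchange would only remove elements and give a feasible set below the minimum
      size.\<close>
    have "v \<notin> X"
    proof
      assume "v \<in> X"
      then have "sym_diff X {e, v} = X - {e, v}" using True by blast
      moreover have "card (X - {e, v}) < card X"
        using True fin[OF X(1)] by (intro psubset_card_mono) auto
      ultimately show False using r_min_le[OF assms(1) v(2)] X by simp
    qed
    then have "sym_diff X {e, v} = insert v (X - {e})" using True by blast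
    moreover have "card (insert v (X - {e})) = card X"
      using \<open>v \<notin> X\<close> True fin[OF X(1)] by (simp add: card_Suc_Diff1 del: card_Diff_insert)
    ultimately show ?thesis using v X \<open>v \<notin> X\<close> True by (intro exI[of _ "insert v (X - {e})"]) auto
  qed (use X in auto)
  then obtain F where F: "F \<in> feasible (delete e D)" "card F = r_min D"
    using assms by (auto simp: mem_delete)
  show ?thesis
    by (rule r_min_eqI[OF delta_matroid_delete[OF assms(1)] F])
      (use assms in \<open>auto simp: mem_delete intro: r_min_le\<close>)
qed

text \<open>
  On vf-safe \<open>D\<close> this is \<open>2 * xi_on (dual D) A - card A\<close>, by \<open>xi_on_dual\<close>.
\<close>

definition pivot_drop :: "'a set_system \<Rightarrow> 'a set \<Rightarrow> int" where
  "pivot_drop D A = int (r_min D) - int (r_min (dual_pivot_set A D))"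

text \<open>Pivots on \<open>A\<close> do not affect whether \<open>e\<close> is a coloop, so
  deleting \<open>e\<close> lowers both values of \<open>r_min\<close> by one or changes
  neither.\<close>

lemma pivot_drop_delete:
  assumes "vf_safe D" "finite A" "A \<subseteq> ground D" "e \<notin> A"
  shows "pivot_drop (delete e D) A = pivot_drop D A"
proof -
  have "delta_matroid D" "delta_matroid (dual_pivot_set A D)"
    using assms by (auto intro: vf_safe_delta_matroid vf_safe_dual_pivot_set)
  then show ?thesis unfolding pivot_drop_def delete_dual_pivot_set[OF assms(2,4), symmetric]
    using is_coloop_dual_pivot_set[OF assms(2,4), of D]
      r_min_delete_coloop[of D e] r_min_delete_coloop[of "dual_pivot_set A D" e]
      r_min_delete_not_coloop[of D e] r_min_delete_not_coloop[of "dual_pivot_set A D" e]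
    by (cases "is_coloop D e") simp_all
qed

lemma pivot_drop_fold_delete:
  assumes "vf_safe D" "finite A" "A \<subseteq> ground D" "A \<inter> set xs = {}"
  shows "pivot_drop (fold delete xs D) A = pivot_drop D A"
  using assms
proof (induction xs arbitrary: D)
  case (Cons e xs)
  then have "pivot_drop (fold delete xs (delete e D)) A = pivot_drop (delete e D) A"
    by (intro Cons.IH) (auto simp: vf_safe_delete)
  also have "\<dots> = pivot_drop D A" using Cons.prems by (intro pivot_drop_delete) auto
  finally show ?case by simp
qed simp

lemma pivot_drop_delete_set:
  assumes "vf_safe D" "finite A" "finite B" "A \<subseteq> ground D" "A \<inter> B = {}"
  shows "pivot_drop (delete_set B D) A = pivot_drop D A"
  using assms by (metis delete_set_fold pivot_drop_fold_delete)

text \<open>The difference telescopes through the intermediate system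
  \<open>dual_pivot_set A D\<close>.\<close>

lemma pivot_drop_Un:
  assumes "finite A" "finite B" "A \<inter> B = {}"
  shows "pivot_drop D (A \<union> B) = pivot_drop D A + pivot_drop (dual_pivot_set A D) B"
  using dual_pivot_set_Un[OF assms] by (simp add: pivot_drop_def)

lemma r_min_le_card_ground:
  assumes "delta_matroid D" shows "r_min D \<le> card (ground D)"
proof -
  obtain F where "F \<in> feasible D" "card F = r_min D" using assms r_min_attained by blast
  then show ?thesis using delta_matroidD[OF assms] by (metis PowD card_mono subsetD)
qed

text \<open>Deleting every element except \<open>e\<close> keeps the drop, and on a one-element
  ground set both values of \<open>r_min\<close> are 0 or 1.\<close>

lemma abs_pivot_drop_singleton_le:
  assumes "vf_safe D" "e \<in> ground D"
  shows "\<bar>pivot_drop D {e}\<bar> \<le> 1"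
proof -
  define D1 where "D1 = delete_set (ground D - {e}) D"
  have fin: "finite (ground D)" using assms by (simp add: vf_safeD)
  have g: "ground D1 = {e}" using assms fin by (auto simp: D1_def ground_delete_set)
  have vf: "vf_safe D1" using assms fin by (simp add: D1_def vf_safe_delete_set)
  have "pivot_drop D {e} = pivot_drop D1 {e}"
    using assms fin by (simp add: D1_def pivot_drop_delete_set)
  moreover have "r_min D1 \<le> 1"
    using r_min_le_card_ground[OF vf_safe_delta_matroid[OF vf]] g by simp
  moreover have "r_min (dual_pivot_set {e} D1) \<le> 1"
    using r_min_le_card_ground[OF vf_safe_delta_matroid[OF vf_safe_dual_pivot_set[of "{e}" D1]]] g vf by simp
  ultimately show ?thesis by (simp add: pivot_drop_def)
qed

lemma abs_pivot_drop_le: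
  assumes "finite A" "vf_safe D" "A \<subseteq> ground D"
  shows "\<bar>pivot_drop D A\<bar> \<le> int (card A)"
  using assms
proof (induction A rule: finite_induct)
  case empty
  then show ?case by (simp add: pivot_drop_def)
next
  case (insert e A)
  have "pivot_drop D (insert e A) = pivot_drop D A + pivot_drop (dual_pivot_set A D) {e}"
    using pivot_drop_Un[of A "{e}" D] insert.hyps by simp
  moreover have "\<bar>pivot_drop (dual_pivot_set A D) {e}\<bar> \<le> 1"
    using insert by (intro abs_pivot_drop_singleton_le) (auto simp: vf_safe_dual_pivot_set)
  ultimately show ?case using insert by (simp add: abs_le_iff)
qed

text \<open>
  With \<open>E\<close> the ground set of \<open>D\<close>, \<open>weight r s D E\<close> is the value of the convolution exponential
  at \<open>D\<close>; \<open>abs_pivot_drop_le\<close> shows that \<^const>\<open>nat\<close> does not truncate. Natural exponents are used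
  because \<open>s\<close> may be \<open>0\<close>.
\<close>

definition weight :: "'k::field \<Rightarrow> 'k \<Rightarrow> 'a set_system \<Rightarrow> 'a set \<Rightarrow> 'k" where
  "weight r s D A = r ^ nat (int (card A) + pivot_drop D A) * s ^ nat (int (card A) - pivot_drop D A)"

text \<open>Cardinalities and drops both add. The bounds from \<open>abs_pivot_drop_le\<close> make
  all exponents nonnegative, so the sums pass through \<open>nat\<close>.\<close>

lemma weight_Un:
  assumes "vf_safe D" "A \<subseteq> ground D" "B \<subseteq> ground D" "A \<inter> B = {}"
  shows "weight r s D (A \<union> B) = weight r s D A * weight r s (dual_pivot_set A D) B"
proof -
  have fin: "finite A" "finite B" using assms by (auto intro: finite_subset dest: vf_safeD(1))
  have "\<bar>pivot_drop D A\<bar> \<le> int (card A)" "\<bar>pivot_drop (dual_pivot_set A D) B\<bar> \<le> int (card B)"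
    using assms fin by (auto intro!: abs_pivot_drop_le vf_safe_dual_pivot_set)
  moreover have "card (A \<union> B) = card A + card B" using assms fin by (simp add: card_Un_disjoint)
  ultimately show ?thesis
    unfolding weight_def pivot_drop_Un[OF fin assms(4)]
    by (simp add: power_add[symmetric] nat_add_distrib[symmetric] algebra_simps)
qed

lemma weight_delete_set:
  assumes "vf_safe D" "A \<subseteq> ground D"
  shows "weight r s (delete_set (ground D - A) D) A = weight r s D A"
  unfolding weight_def
  using assms by (subst (1 2) pivot_drop_delete_set) (auto intro: finite_subset dest: vf_safeD(1))

text \<open>The right factor of the coproduct is the pivoted system with \<open>A\<close> deleted,
  which is \<open>weight_delete_set\<close> for the subset \<open>ground D - A\<close>.\<close>

lemma weight_contract_set:
  assumes "vf_safe D" "A \<subseteq> ground D"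
  shows "weight r s (contract_set A (loop_compl_set A D)) (ground D - A)
    = weight r s (dual_pivot_set A D) (ground D - A)"
proof -
  have fin: "finite A" "finite (ground D)" using assms by (auto intro: finite_subset dest: vf_safeD(1))
  have "vf_safe (dual_pivot_set A D)" using assms fin by (simp add: vf_safe_dual_pivot_set)
  from weight_delete_set[OF this, of "ground D - A" r s] assms(2) fin show ?thesis
    by (simp add: contract_set_loop_compl_set double_diff)
qed

text \<open>Complementing feasible sets exchanges those containing \<open>e\<close> with those
  avoiding \<open>e\<close>, and hence the roles of loop complementation and dual pivot.\<close>

lemma loop_compl_dual:
  assumes "e \<in> ground D" shows "loop_compl e (dual D) = dual (dual_pivot e D)"
proof (rule set_system_eqI)
  fix F
  let ?E = "ground D"
  have "e \<in> F \<Longrightarrow> sym_diff ?E (F - {e}) = insert e (sym_diff ?E F)" using assms by blast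
  moreover have "e \<in> F \<longleftrightarrow> \<not> (e \<in> sym_diff ?E F)" using assms by blast
  ultimately show "F \<in> feasible (loop_compl e (dual D)) \<longleftrightarrow> F \<in> feasible (dual (dual_pivot e D))"
    unfolding dual_def mem_loop_compl mem_twist mem_dual_pivot ground_dual_pivot by metis
qed simp

lemma loop_compl_set_dual:
  assumes "finite A" "A \<subseteq> ground D" shows "loop_compl_set A (dual D) = dual (dual_pivot_set A D)"
  using assms by induction (simp_all add: loop_compl_set_insert dual_pivot_set_insert loop_compl_dual)

lemma r_max_dual:
  assumes "delta_matroid D" shows "r_max (dual D) = card (ground D) - r_min D"
proof -
  note dm = delta_matroidD[OF assms]
  have c: "card (sym_diff (ground D) F) = card (ground D) - card F" if "F \<in> feasible D" for F
  proof -
    have "sym_diff (ground D) F = ground D - F" using dm(2) that by blast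
    then show ?thesis using dm that by (simp add: card_Diff_subset Pow_def subset_iff)
  qed
  have f: "feasible (dual D) = (\<lambda>F. sym_diff (ground D) F) ` feasible D"
    by (simp add: dual_def twist_def)
  obtain F where F: "F \<in> feasible D" "card F = r_min D" using r_min_attained[OF assms] by blast
  show ?thesis unfolding r_max_def
  proof (rule Max_eqI)
    show "card (ground D) - r_min D \<in> card ` feasible (dual D)"
      unfolding f by (rule rev_image_eqI[OF imageI[OF F(1)]]) (simp only: c[OF F(1)] F(2))
  next
    fix y assume "y \<in> card ` feasible (dual D)"
    then obtain G where G: "G \<in> feasible D" "y = card (sym_diff (ground D) G)"
      unfolding f by (elim imageE) simp
    show "y \<le> card (ground D) - r_min D"
      unfolding G(2) c[OF G(1)] by (rule diff_le_mono2[OF r_min_le[OF assms G(1)]])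
  qed (simp add: f dm)
qed

lemma xi_on_dual:
  assumes "vf_safe D" "A \<subseteq> ground D"
  shows "xi_on (dual D) A = of_int (int (card A) + pivot_drop D A) / 2"
proof -
  have fin: "finite A" using assms by (auto intro: finite_subset dest: vf_safeD(1))
  have dm: "delta_matroid D" "delta_matroid (dual_pivot_set A D)"
    using assms fin by (auto intro: vf_safe_delta_matroid vf_safe_dual_pivot_set)
  \<comment> \<open>These bounds make the natural subtractions coming from \<open>r_max_dual\<close>
    exact, so that the common term \<open>card (ground D)\<close> cancels.\<close>
  then have "r_min D \<le> card (ground D)" "r_min (dual_pivot_set A D) \<le> card (ground D)"
    using r_min_le_card_ground[OF dm(1)] r_min_le_card_ground[OF dm(2)] fin by simp_all
  then show ?thesis
    using dm fin assms
    by (simp add: xi_on_def loop_compl_set_dual r_max_dual pivot_drop_def of_nat_diff)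
qed

section \<open>Isomorphism invariance\<close>

text \<open>The coproduct is evaluated on the representative \<open>dm_rep\<close> over
  \<open>nat\<close>, so everything attached to \<open>D\<close> has to be transported along
  relabellings.\<close>

definition map_system :: "('a \<Rightarrow> 'b) \<Rightarrow> 'a set_system \<Rightarrow> 'b set_system" where
  "map_system f D = Set_System (f ` ground D) ((\<lambda>F. f ` F) ` feasible D)"

lemma ground_map_system [simp]: "ground (map_system f D) = f ` ground D"
  by (simp add: map_system_def)

lemma feasible_map_system: "feasible (map_system f D) = (\<lambda>F. f ` F) ` feasible D"
  by (simp add: map_system_def)

text \<open>This is what lets a map injective only on the ground set act injectively on feasible
  sets. It passes through each single twist and loop complementation by ground elements.\<close>

definition well_formed :: "'a set_system \<Rightarrow> bool" where
  "well_formed D \<longleftrightarrow> feasible D \<subseteq> Pow (ground D)"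

lemma well_formed_subset: "well_formed D \<Longrightarrow> F \<in> feasible D \<Longrightarrow> F \<subseteq> ground D"
  unfolding well_formed_def by (meson PowD subsetD)

lemma well_formedI: "(\<And>F. F \<in> feasible D \<Longrightarrow> F \<subseteq> ground D) \<Longrightarrow> well_formed D"
  unfolding well_formed_def by blast

lemma delta_matroid_well_formed: "delta_matroid D \<Longrightarrow> well_formed D"
  by (simp add: well_formed_def delta_matroidD)

lemma well_formed_eqI:
  assumes "well_formed D" "well_formed D'" "ground D = ground D'"
    and "\<And>F. F \<subseteq> ground D \<Longrightarrow> F \<in> feasible D \<longleftrightarrow> F \<in> feasible D'"
  shows "D = D'"
proof (rule set_system_eqI[OF assms(3)])
  fix F
  have "F \<subseteq> ground D" if "F \<in> feasible D \<or> F \<in> feasible D'"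
    using that well_formed_subset[OF assms(1)] well_formed_subset[OF assms(2)] assms(3) by auto
  then show "F \<in> feasible D \<longleftrightarrow> F \<in> feasible D'" using assms(4) by blast
qed

lemma well_formed_twist:
  assumes "well_formed D" "A \<subseteq> ground D" shows "well_formed (twist A D)"
proof (rule well_formedI)
  fix F assume "F \<in> feasible (twist A D)"
  then have "sym_diff A F \<subseteq> ground D"
    unfolding mem_twist by (rule well_formed_subset[OF assms(1)])
  then show "F \<subseteq> ground (twist A D)" using assms(2) unfolding ground_simps by blast
qed

lemma well_formed_loop_compl:
  assumes "well_formed D" "e \<in> ground D" shows "well_formed (loop_compl e D)"
proof (rule well_formedI)
  fix F assume "F \<in> feasible (loop_compl e D)"
  then have "F \<subseteq> ground D \<or> F - {e} \<subseteq> ground D"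
    unfolding mem_loop_compl using well_formed_subset[OF assms(1)] by metis
  then show "F \<subseteq> ground (loop_compl e D)" using assms(2) unfolding ground_simps by blast
qed

lemma well_formed_map_system: "well_formed D \<Longrightarrow> well_formed (map_system f D)"
  by (rule well_formedI) (auto simp: feasible_map_system dest: well_formed_subset)

lemma mem_map_system:
  assumes "inj_on f (ground D)" "well_formed D" "F \<subseteq> ground D"
  shows "f ` F \<in> feasible (map_system f D) \<longleftrightarrow> F \<in> feasible D"
proof
  assume "f ` F \<in> feasible (map_system f D)"
  then obtain G where G: "G \<in> feasible D" "f ` F = f ` G" by (auto simp: feasible_map_system)
  then have "F = G"
    using inj_on_image_eq_iff[OF assms(1,3) well_formed_subset[OF assms(2) G(1)]] by simp
  with G show "F \<in> feasible D" by simp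
qed (simp add: feasible_map_system)

lemma image_sym_diff:
  assumes "inj_on f E" "A \<subseteq> E" "B \<subseteq> E"
  shows "f ` sym_diff A B = sym_diff (f ` A) (f ` B)"
  using inj_on_image_set_diff[OF assms(1), of A B] inj_on_image_set_diff[OF assms(1), of B A] assms
  by (simp add: image_Un Diff_subset subset_trans[OF Diff_subset])

lemma map_system_twist:
  assumes "inj_on f (ground D)" "well_formed D" "A \<subseteq> ground D"
  shows "map_system f (twist A D) = twist (f ` A) (map_system f D)"
proof -
  have "(\<lambda>F. f ` sym_diff A F) ` feasible D = (\<lambda>F. sym_diff (f ` A) (f ` F)) ` feasible D"
    by (rule image_cong[OF HOL.refl image_sym_diff[OF assms(1,3) well_formed_subset[OF assms(2)]]])
  then show ?thesis
    unfolding map_system_def twist_def set_system.sel image_image by (simp only:)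
qed

lemma map_system_loop_compl:
  assumes "inj_on f (ground D)" "well_formed D" "e \<in> ground D"
  shows "map_system f (loop_compl e D) = loop_compl (f e) (map_system f D)"
proof (rule well_formed_eqI)
  fix F assume "F \<subseteq> ground (map_system f (loop_compl e D))"
  then obtain G where G: "G \<subseteq> ground D" "F = f ` G" by (auto simp: subset_image_iff)
  have "G - {e} \<subseteq> ground D" using G by blast
  have e: "f e \<in> f ` G \<longleftrightarrow> e \<in> G" by (rule inj_on_image_mem_iff[OF assms(1,3) G(1)])
  have d: "f ` G - {f e} = f ` (G - {e})"
    using inj_on_image_set_diff[OF assms(1), of G "{e}"] G assms(3) by simp blast
  show "F \<in> feasible (map_system f (loop_compl e D)) \<longleftrightarrow>
      F \<in> feasible (loop_compl (f e) (map_system f D))"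
    using assms G(1) \<open>G - {e} \<subseteq> ground D\<close>
    by (simp add: G(2) mem_map_system mem_loop_compl well_formed_loop_compl e d)
qed (use assms in \<open>simp_all add: well_formed_loop_compl well_formed_map_system\<close>)

lemma map_system_dual_pivot:
  assumes "inj_on f (ground D)" "well_formed D" "e \<in> ground D"
  shows "map_system f (dual_pivot e D) = dual_pivot (f e) (map_system f D)"
  using assms unfolding dual_pivot_def
  by (simp add: map_system_twist map_system_loop_compl well_formed_twist well_formed_loop_compl)

lemma well_formed_dual_pivot: "well_formed D \<Longrightarrow> e \<in> ground D \<Longrightarrow> well_formed (dual_pivot e D)"
  by (simp add: dual_pivot_def well_formed_twist well_formed_loop_compl)

text \<open>Well-formedness is proved simultaneously because relabelling the next dual pivot
  requires it of the system reached so far.\<close>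

lemma map_system_dual_pivot_set:
  assumes "finite A" "inj_on f (ground D)" "well_formed D" "A \<subseteq> ground D"
  shows "map_system f (dual_pivot_set A D) = dual_pivot_set (f ` A) (map_system f D) \<and> well_formed (dual_pivot_set A D)"
  using assms
proof (induction A rule: finite_induct)
  case (insert e A)
  then have "f e \<notin> f ` A" by (subst inj_on_image_mem_iff[of f "ground D"]) auto
  with insert show ?case by (simp add: dual_pivot_set_insert map_system_dual_pivot well_formed_dual_pivot)
qed simp

lemma r_min_map_system:
  assumes "inj_on f (ground D)" "well_formed D"
  shows "r_min (map_system f D) = r_min D"
proof -
  have "card (f ` F) = card F" if "F \<in> feasible D" for F
    by (rule card_image[OF inj_on_subset[OF assms(1) well_formed_subset[OF assms(2) that]]])
  then have "(\<lambda>F. card (f ` F)) ` feasible D = card ` feasible D"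
    by (intro image_cong) simp_all
  then show ?thesis by (simp add: r_min_def feasible_map_system image_image)
qed

lemma pivot_drop_map_system:
  assumes "finite A" "inj_on f (ground D)" "well_formed D" "A \<subseteq> ground D"
  shows "pivot_drop (map_system f D) (f ` A) = pivot_drop D A"
  using map_system_dual_pivot_set[OF assms] assms
    r_min_map_system[of f D] r_min_map_system[of f "dual_pivot_set A D"]
  by (simp add: pivot_drop_def)

lemma delta_matroid_map_system:
  assumes "delta_matroid D" "inj_on f (ground D)"
  shows "delta_matroid (map_system f D)"
proof -
  note wf = delta_matroid_well_formed[OF assms(1)]
  have "\<exists>v\<in>sym_diff X Y. sym_diff X {u, v} \<in> feasible (map_system f D)"
    if "X \<in> feasible (map_system f D)" "Y \<in> feasible (map_system f D)" "u \<in> sym_diff X Y" for X Y u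
  proof -
    obtain F G where FG: "F \<in> feasible D" "G \<in> feasible D" "X = f ` F" "Y = f ` G"
      using \<open>X \<in> _\<close> \<open>Y \<in> _\<close> unfolding feasible_map_system by (elim imageE) blast
    note sub = well_formed_subset[OF wf FG(1)] well_formed_subset[OF wf FG(2)]
    have d: "sym_diff X Y = f ` sym_diff F G"
      unfolding FG using image_sym_diff[OF assms(2) sub] by (rule sym)
    obtain w where w: "w \<in> sym_diff F G" "u = f w" using \<open>u \<in> _\<close> unfolding d by (rule imageE)
    obtain v where v: "v \<in> sym_diff F G" "sym_diff F {w, v} \<in> feasible D"
      using delta_matroid_exchange[OF assms(1) FG(1,2) w(1)] .
    have "{w, v} \<subseteq> ground D" using v(1) w(1) sub by blast
    from image_sym_diff[OF assms(2) sub(1) this]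
    have "f ` sym_diff F {w, v} = sym_diff X {u, f v}"
      unfolding FG(3) w(2) by (simp only: image_insert image_empty)
    from imageI[OF v(2), of "(`) f", unfolded this]
    have "sym_diff X {u, f v} \<in> feasible (map_system f D)"
      unfolding feasible_map_system .
    then show ?thesis using imageI[OF v(1), of f] unfolding d by (rule bexI)
  qed
  moreover have "feasible (map_system f D) \<subseteq> Pow (ground (map_system f D))"
    using well_formed_map_system[OF wf] unfolding well_formed_def .
  moreover have "feasible (map_system f D) \<noteq> {}" "finite (ground (map_system f D))"
    using delta_matroidD[OF assms(1)] by (simp_all add: feasible_map_system)
  ultimately show ?thesis unfolding delta_matroid_def by (intro conjI ballI)
qed

text \<open>Each operation on the relabelled system is the image of one on the original. The
  unchanged ground set is recorded so that \<open>f\<close> stays injective throughout.\<close>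

lemma reachable_map_system:
  assumes "twist_loop_reachable (map_system f D) D''" "inj_on f (ground D)" "well_formed D"
  shows "\<exists>D'. twist_loop_reachable D D' \<and> ground D' = ground D \<and> well_formed D' \<and> D'' = map_system f D'"
  using assms(1)
proof (induction rule: twist_loop_reachable.induct)
  case (twist D'' A)
  then obtain D' where D': "twist_loop_reachable D D'" "ground D' = ground D" "well_formed D'"
    "D'' = map_system f D'" by blast
  with twist.hyps(2) obtain B where B: "B \<subseteq> ground D'" "A = f ` B" by (auto simp: subset_image_iff)
  have "twist A D'' = map_system f (twist B D')"
    using map_system_twist[of f D' B] D' B assms(2) by simp
  moreover have "twist_loop_reachable D (twist B D')" "well_formed (twist B D')"
    using D' B by (auto intro: twist_loop_reachable.intros well_formed_twist)
  ultimately show ?case using D'(2) ground_simps(1) by metis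
next
  case (loop_compl D'' e)
  then obtain D' where D': "twist_loop_reachable D D'" "ground D' = ground D" "well_formed D'"
    "D'' = map_system f D'" by blast
  with loop_compl.hyps(2) obtain c where c: "c \<in> ground D'" "e = f c" by auto
  have "loop_compl e D'' = map_system f (loop_compl c D')"
    using map_system_loop_compl[of f D' c] D' c assms(2) by simp
  moreover have "twist_loop_reachable D (loop_compl c D')" "well_formed (loop_compl c D')"
    using D' c by (auto intro: twist_loop_reachable.intros well_formed_loop_compl)
  ultimately show ?case using D'(2) ground_simps(2) by metis
qed (use assms twist_loop_reachable.refl in blast)

lemma vf_safe_well_formed: "vf_safe D \<Longrightarrow> well_formed D"
  by (simp add: delta_matroid_well_formed vf_safe_delta_matroid)

lemma vf_safe_map_system:
  assumes "vf_safe D" "inj_on f (ground D)" shows "vf_safe (map_system f D)"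
  unfolding vf_safe_def
proof (intro allI impI)
  fix D'' assume "twist_loop_reachable (map_system f D) D''"
  from reachable_map_system[OF this assms(2) vf_safe_well_formed[OF assms(1)]]
  obtain D' where D': "twist_loop_reachable D D'" "ground D' = ground D" "D'' = map_system f D'"
    by (elim exE conjE)
  have "delta_matroid D'" using assms(1) D'(1) by (simp add: vf_safe_def)
  then show "delta_matroid D''" using assms(2) D' by (simp add: delta_matroid_map_system)
qed

section \<open>Isomorphism classes and their representatives\<close>

lemma iso_iff_map_system: "iso D D' \<longleftrightarrow> (\<exists>f. inj_on f (ground D) \<and> D' = map_system f D)"
proof
  assume "iso D D'"
  then obtain f where "bij_betw f (ground D) (ground D')" "feasible D' = (\<lambda>F. f ` F) ` feasible D"
    by (auto simp: iso_def)
  then have "inj_on f (ground D)" "D' = map_system f D"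
    by (auto simp: bij_betw_def feasible_map_system intro!: set_system.expand)
  then show "\<exists>f. inj_on f (ground D) \<and> D' = map_system f D" by blast
next
  assume "\<exists>f. inj_on f (ground D) \<and> D' = map_system f D"
  then obtain f where "inj_on f (ground D)" "D' = map_system f D" by blast
  then show "iso D D'" unfolding iso_def
    by (intro exI[of _ f]) (simp add: bij_betw_def feasible_map_system)
qed

lemma map_system_map_system: "map_system g (map_system f D) = map_system (g \<circ> f) D"
  by (simp add: map_system_def image_image image_comp)

lemma iso_trans: "iso D D' \<Longrightarrow> iso D' D'' \<Longrightarrow> iso D D''"
  unfolding iso_iff_map_system
  by (metis comp_inj_on ground_map_system map_system_map_system)

text \<open>The inverse relabelling undoes \<open>f\<close> only inside the ground set, hence the
  assumption that feasible sets lie there.\<close>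

lemma iso_sym:
  assumes "iso D D'" "well_formed D" shows "iso D' D"
proof -
  obtain f where f: "inj_on f (ground D)" "D' = map_system f D"
    using assms by (auto simp: iso_iff_map_system)
  let ?g = "inv_into (ground D) f"
  have "?g ` f ` F = F" if "F \<subseteq> ground D" for F
    by (rule inv_into_image_cancel[OF f(1) that])
  then have "map_system ?g D' = D"
    using well_formed_subset[OF assms(2)] unfolding f(2)
    by (intro set_system.expand) (simp add: feasible_map_system image_image)
  moreover have "inj_on ?g (ground D')" unfolding f(2) by (simp add: inj_on_inv_into)
  ultimately show ?thesis unfolding iso_iff_map_system by metis
qed

lemma vf_safe_iso: "vf_safe D \<Longrightarrow> iso D D' \<Longrightarrow> vf_safe D'"
  by (auto simp: iso_iff_map_system vf_safe_map_system)

lemma iso_class_eqI: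
  assumes "iso D D'" "well_formed D" shows "iso_class D = iso_class D'"
  unfolding iso_class_def
proof (rule Collect_cong)
  fix D'' :: "nat set_system"
  show "iso D D'' \<longleftrightarrow> iso D' D''"
    using iso_trans[OF assms(1), of D''] iso_trans[OF iso_sym[OF assms], of D''] by blast
qed

lemma vf_safe_nat_copy:
  assumes "vf_safe D" obtains D' :: "nat set_system" where "vf_safe D'" "iso D D'"
proof -
  obtain f :: "'a \<Rightarrow> nat" where "bij_betw f (ground D) {0..<card (ground D)}"
    using ex_bij_betw_finite_nat[OF vf_safeD(1)[OF assms]] by blast
  then have "iso D (map_system f D)" by (auto simp: iso_iff_map_system bij_betw_def)
  then show ?thesis using that vf_safe_iso[OF assms] by blast
qed

text \<open>A copy of \<open>D\<close> over \<open>nat\<close> shows that its class belongs to the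
  carrier of \<open>dm_class\<close>, whatever the type of the ground elements.\<close>

lemma Rep_dm_class_of:
  assumes "vf_safe D" shows "Rep_dm_class (dm_class_of D) = iso_class D"
proof -
  obtain D' :: "nat set_system" where "vf_safe D'" "iso D D'" using vf_safe_nat_copy[OF assms] .
  moreover from this have "iso_class D = iso_class D'"
    by (intro iso_class_eqI vf_safe_well_formed assms)
  ultimately have "iso_class D \<in> {iso_class D | D :: nat set_system. vf_safe D}" by blast
  then show ?thesis by (simp add: dm_class_of_def Abs_dm_class_inverse)
qed

lemma dm_rep:
  assumes "vf_safe D"
  shows "iso D (dm_rep (dm_class_of D))" "vf_safe (dm_rep (dm_class_of D))"
proof -
  obtain D' :: "nat set_system" where "iso D D'" using vf_safe_nat_copy[OF assms] .
  then have "D' \<in> Rep_dm_class (dm_class_of D)" by (simp add: Rep_dm_class_of[OF assms] iso_class_def)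
  then have "dm_rep (dm_class_of D) \<in> Rep_dm_class (dm_class_of D)"
    unfolding dm_rep_def by (rule someI)
  then show "iso D (dm_rep (dm_class_of D))" by (simp add: Rep_dm_class_of[OF assms] iso_class_def)
  then show "vf_safe (dm_rep (dm_class_of D))" by (rule vf_safe_iso[OF assms])
qed

lemma dm_class_of_eq_iff:
  fixes D :: "'a set_system" and D' :: "'b set_system"
  assumes "vf_safe D" "vf_safe D'"
  shows "dm_class_of D = dm_class_of D' \<longleftrightarrow> iso D D'"
proof
  assume "dm_class_of D = dm_class_of D'"
  then have "iso D' (dm_rep (dm_class_of D))" using dm_rep(1)[OF assms(2)] by simp
  from iso_trans[OF dm_rep(1)[OF assms(1)] iso_sym[OF this vf_safe_well_formed[OF assms(2)]]]
  show "iso D D'" .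
next
  assume "iso D D'"
  then show "dm_class_of D = dm_class_of D'"
    by (simp add: dm_class_of_def iso_class_eqI vf_safe_well_formed assms)
qed

lemma dm_rep_map_system:
  assumes "vf_safe D"
  obtains f where "inj_on f (ground D)" "dm_rep (dm_class_of D) = map_system f D"
  using dm_rep(1)[OF assms] unfolding iso_iff_map_system by blast

lemma weight_map_system:
  assumes "vf_safe D" "inj_on f (ground D)" "A \<subseteq> ground D"
  shows "weight r s (map_system f D) (f ` A) = weight r s D A"
proof -
  have "finite A" using assms by (auto intro: finite_subset dest: vf_safeD(1))
  moreover have "card (f ` A) = card A" using assms by (meson card_image inj_on_subset)
  ultimately show ?thesis
    using assms by (simp add: weight_def pivot_drop_map_system vf_safe_well_formed)
qed

section \<open>Convolution exponentials\<close>

lemma lin_fun_superset: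
  assumes "finite S" "Poly_Mapping.keys h \<subseteq> S"
  shows "lin_fun \<phi> h = (\<Sum>b\<in>S. Poly_Mapping.lookup h b * \<phi> b)"
  unfolding lin_fun_def using assms by (intro sum.mono_neutral_left) (auto simp: in_keys_iff)

lemma lin_fun_zero: "lin_fun \<phi> 0 = 0"
  by (simp add: lin_fun_def)

lemma lin_fun_add: "lin_fun \<phi> (g + h) = lin_fun \<phi> g + lin_fun \<phi> h"
proof -
  let ?S = "Poly_Mapping.keys g \<union> Poly_Mapping.keys h"
  have "lin_fun \<phi> (g + h) = (\<Sum>b\<in>?S. Poly_Mapping.lookup (g + h) b * \<phi> b)"
    by (rule lin_fun_superset[OF _ Poly_Mapping.keys_add]) simp
  also have "\<dots> = (\<Sum>b\<in>?S. Poly_Mapping.lookup g b * \<phi> b) + (\<Sum>b\<in>?S. Poly_Mapping.lookup h b * \<phi> b)"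
    by (simp add: lookup_add distrib_right sum.distrib)
  also have "\<dots> = lin_fun \<phi> g + lin_fun \<phi> h"
    by (simp add: lin_fun_superset[of ?S])
  finally show ?thesis .
qed

lemma lin_fun_sum: "lin_fun \<phi> (\<Sum>i\<in>I. h i) = (\<Sum>i\<in>I. lin_fun \<phi> (h i))"
  by (induction I rule: infinite_finite_induct) (simp_all add: lin_fun_zero lin_fun_add)

lemma lin_fun_basis [simp]: "lin_fun \<phi> (basis b) = \<phi> b"
  by (simp add: lin_fun_def)

lemma lin_map_basis [simp]: "lin_map \<phi> (basis b) = \<phi> b"
proof -
  have "Poly_Mapping.map ((*) 1) (\<phi> b) = \<phi> b"
    by (rule poly_mapping_eqI) (simp add: Poly_Mapping.map.rep_eq when_def)
  then show ?thesis by (simp add: lin_map_def)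
qed

lemma conv_basis:
  fixes C :: dm_class and f g :: "'k::field hopf \<Rightarrow> 'k"
  defines "D \<equiv> dm_rep C"
  shows "conv f g (basis C) = (\<Sum>A\<in>Pow (ground D).
     f (basis (dm_class_of (delete_set (ground D - A) D)))
     * g (basis (dm_class_of (contract_set A (loop_compl_set A D)))))"
  by (simp add: conv_def mult_tensor_def coproduct_def lin_fun_sum Let_def D_def)

section \<open>One-element delta-matroids\<close>

lemma delta_matroid_singleton:
  assumes "ground D = {e}" "well_formed D" "feasible D \<noteq> {}"
  shows "delta_matroid D"
proof -
  have sub: "F = {} \<or> F = {e}" if "F \<in> feasible D" for F
    using well_formed_subset[OF assms(2) that] unfolding assms(1) by (rule subset_singletonD)
  have "\<exists>v\<in>sym_diff X Y. sym_diff X {u, v} \<in> feasible D"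
    if X: "X \<in> feasible D" and Y: "Y \<in> feasible D" and u: "u \<in> sym_diff X Y" for X Y u
  \<comment> \<open>Two different subsets of \<open>{e}\<close> differ exactly in \<open>e\<close>,
    so the exchange with \<open>v = u\<close> leads straight to \<open>Y\<close>.\<close>
  proof (rule bexI[OF _ u])
    have "u = e" "sym_diff X {u, u} = Y" using u sub[OF X] sub[OF Y] by auto
    then show "sym_diff X {u, u} \<in> feasible D" using Y by (simp only:)
  qed
  then show ?thesis
    using assms(1,3) assms(2)[unfolded well_formed_def] unfolding delta_matroid_def
    by (intro conjI ballI) simp_all
qed

lemma vf_safe_singleton:
  assumes "ground D = {e}" "well_formed D" "feasible D \<noteq> {}"
  shows "vf_safe D"
  unfolding vf_safe_def
proof (intro allI impI)
  fix D' assume "twist_loop_reachable D D'"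
  then have "ground D' = {e} \<and> well_formed D' \<and> feasible D' \<noteq> {}"
  proof (induction rule: twist_loop_reachable.induct)
    case (twist D' A)
    then show ?case by (simp add: well_formed_twist) (simp add: twist_def)
  next
    case (loop_compl D' c)
    then have c: "c = e" and wf: "well_formed D'" and g: "ground D' = {e}" by auto
    obtain F where F: "F \<in> feasible D'" using loop_compl by blast
    have "F = {} \<or> F = {e}" using well_formed_subset[OF wf F] unfolding g by (rule subset_singletonD)
    \<comment> \<open>The empty set is never cancelled; if it is not feasible, nothing cancels
      \<open>{e}\<close>.\<close>
    with F have "{} \<in> feasible (loop_compl e D') \<or> {e} \<in> feasible (loop_compl e D')"
      by (auto simp: mem_loop_compl)
    then show ?case using wf g c by (auto simp: well_formed_loop_compl)
  qed (use assms in simp)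
  then show "delta_matroid D'" by (elim conjE) (rule delta_matroid_singleton)
qed

lemma iso_card_ground: "iso D D' \<Longrightarrow> card (ground D) = card (ground D')"
  unfolding iso_def by (metis bij_betw_same_card)

lemma vf_safe_standard:
  "vf_safe (Set_System {e} {{e}})" "vf_safe (Set_System {e} {{}})" "vf_safe (Set_System {e} {{}, {e}})"
  by (rule vf_safe_singleton[of _ e]; simp add: well_formed_def)+

lemma standard_not_iso:
  "\<not> iso (Set_System {e} {{e}}) (Set_System {e'} {{}})"
  "\<not> iso (Set_System {e} {{e}}) (Set_System {e'} {{}, {e'}})"
  "\<not> iso (Set_System {e} {{}}) (Set_System {e'} {{e'}})"
  "\<not> iso (Set_System {e} {{}}) (Set_System {e'} {{}, {e'}})"
  "\<not> iso (Set_System {e} {{}, {e}}) (Set_System {e'} {{}})"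
  "\<not> iso (Set_System {e} {{}, {e}}) (Set_System {e'} {{e'}})"
  unfolding iso_def by auto

lemma standard_iso:
  "iso (Set_System {e} {{e}}) (Set_System {e'} {{e'}})"
  "iso (Set_System {e} {{}}) (Set_System {e'} {{}})"
  "iso (Set_System {e} {{}, {e}}) (Set_System {e'} {{}, {e'}})"
  unfolding iso_def by (rule exI[of _ "\<lambda>_. e'"]; simp add: bij_betw_def)+

lemma delta_hat_basis:
  assumes "vf_safe D"
  shows "delta_hat (c, l, n) (basis (dm_class_of D)) =
    (if iso D (Set_System {0 :: nat} {{0}}) then c else 0) +
    (if iso D (Set_System {0 :: nat} {{}}) then l else 0) +
    (if iso D (Set_System {0 :: nat} {{}, {0}}) then n else 0)"
  by (simp add: delta_hat_def delta_c_def delta_o_def delta_n_def indicator_functional_def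
      dm_class_of_eq_iff assms vf_safe_standard)

lemma dual_pivot_standard:
  "feasible (dual_pivot e (Set_System {e} {{e}})) = {{}, {e}}"
  "feasible (dual_pivot e (Set_System {e} {{}})) = {{}}"
  "feasible (dual_pivot e (Set_System {e} {{}, {e}})) = {{e}}"
  by (rule set_eqI, auto simp: mem_dual_pivot)+

text \<open>With cardinality 1 these drops give the weights \<open>r^2\<close>, \<open>r * s\<close>
  and \<open>s^2\<close>, the coefficients of \<open>delta_c\<close>, \<open>delta_o\<close> and
  \<open>delta_n\<close>.\<close>

lemma pivot_drop_standard:
  "pivot_drop (Set_System {e} {{e}}) {e} = 1"
  "pivot_drop (Set_System {e} {{}}) {e} = 0"
  "pivot_drop (Set_System {e} {{}, {e}}) {e} = -1"
  by (simp_all add: pivot_drop_def dual_pivot_set_insert r_min_def dual_pivot_standard)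

text \<open>In degree 1 the coloop, the loop and the system with both subsets feasible are the only
  cases; in other degrees all three indicators vanish.\<close>

lemma delta_hat_weight:
  assumes "vf_safe D"
  shows "delta_hat (r\<^sup>2, r * s, s\<^sup>2) (basis (dm_class_of D)) =
    (if card (ground D) = 1 then weight r s D (ground D) else 0)"
proof (cases "card (ground D) = 1")
  case True
  then obtain e where e: "ground D = {e}" by (meson card_1_singletonE)
  have "feasible D \<subseteq> {{}, {e}}" "feasible D \<noteq> {}"
    using vf_safeD[OF assms] e by (auto simp: Pow_insert)
  then have "feasible D = {{e}} \<or> feasible D = {{}} \<or> feasible D = {{}, {e}}" by blast
  then have "D = Set_System {e} {{e}} \<or> D = Set_System {e} {{}} \<or> D = Set_System {e} {{}, {e}}"
    using e by (metis set_system.collapse)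
  then show ?thesis
    by (elim disjE; simp add: delta_hat_basis vf_safe_standard standard_iso standard_not_iso
        weight_def pivot_drop_standard nat_numeral_diff_1)
next
  case False
  then have "\<not> iso D (Set_System {0 :: nat} S)" for S
    using iso_card_ground[of D "Set_System {0 :: nat} S"] by auto
  with False show ?thesis by (simp add: delta_hat_basis assms)
qed

section \<open>Convolution powers and exponentials\<close>

lemma counit_basis:
  assumes "vf_safe D"
  shows "counit (basis (dm_class_of D)) = (if ground D = {} then 1 else 0)"
proof -
  have "iso D (Set_System {} {{}} :: nat set_system) \<longleftrightarrow> ground D = {}"
  proof
    assume "ground D = {}"
    moreover from this have "feasible D = {{}}" using vf_safeD[OF assms] by auto
    ultimately show "iso D (Set_System {} {{}} :: nat set_system)" by (simp add: iso_def bij_betw_def)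
  qed (auto simp: iso_def bij_betw_def)
  then show ?thesis by (simp add: counit_def dm_class_of_eq_iff assms vf_safe_empty)
qed

lemma vf_safe_minors:
  assumes "vf_safe D" "A \<subseteq> ground D"
  shows "vf_safe (delete_set (ground D - A) D)" "ground (delete_set (ground D - A) D) = A"
    "vf_safe (contract_set A (loop_compl_set A D))"
    "ground (contract_set A (loop_compl_set A D)) = ground D - A"
proof -
  have fin: "finite A" "finite (ground D)" using assms by (auto intro: finite_subset dest: vf_safeD(1))
  show "vf_safe (delete_set (ground D - A) D)" "ground (delete_set (ground D - A) D) = A"
    using fin assms by (auto simp: vf_safe_delete_set ground_delete_set)
  show "vf_safe (contract_set A (loop_compl_set A D))"
    "ground (contract_set A (loop_compl_set A D)) = ground D - A"
    using fin assms
    by (simp_all add: contract_set_loop_compl_set vf_safe_delete_set vf_safe_dual_pivot_set ground_delete_set)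
qed

lemma weight_dm_rep:
  assumes "vf_safe D"
  shows "weight r s (dm_rep (dm_class_of D)) (ground (dm_rep (dm_class_of D))) = weight r s D (ground D)"
    "card (ground (dm_rep (dm_class_of D))) = card (ground D)"
proof -
  obtain f where f: "inj_on f (ground D)" "dm_rep (dm_class_of D) = map_system f D"
    using dm_rep_map_system[OF assms] .
  show "weight r s (dm_rep (dm_class_of D)) (ground (dm_rep (dm_class_of D))) = weight r s D (ground D)"
    using weight_map_system[OF assms f(1), of "ground D"] by (simp add: f(2))
  show "card (ground (dm_rep (dm_class_of D))) = card (ground D)"
    by (simp add: f card_image)
qed

text \<open>Splitting off one factor leaves only singletons \<open>A\<close>, since
  \<open>delta_hat\<close> lives in degree 1. By multiplicativity each contributes
  \<open>fact k\<close> times the full weight, and there are \<open>Suc k\<close> of them. The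
  induction stays over \<open>nat\<close> because minors of representatives do.\<close>

lemma conv_power_delta_hat:
  fixes D :: "nat set_system" and r s :: "'k::field_char_0"
  assumes "vf_safe D"
  shows "conv_power (delta_hat (r\<^sup>2, r * s, s\<^sup>2)) k (basis (dm_class_of D)) =
    (if k = card (ground D) then fact k * weight r s D (ground D) else 0)"
  using assms
proof (induction k arbitrary: D)
  case 0
  then have "finite (ground D)" by (rule vf_safeD(1))
  with 0 show ?case by (auto simp: counit_basis weight_def pivot_drop_def)
next
  case (Suc k)
  define D0 where "D0 = dm_rep (dm_class_of D)"
  define E where "E = ground D0"
  let ?\<delta> = "delta_hat (r\<^sup>2, r * s, s\<^sup>2)"
  have vf: "vf_safe D0" using dm_rep(2)[OF Suc.prems] by (simp add: D0_def)
  have fin: "finite E" using vf_safeD(1)[OF vf] by (simp add: E_def)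
  have "conv_power ?\<delta> (Suc k) (basis (dm_class_of D)) =
    (\<Sum>A\<in>Pow E. ?\<delta> (basis (dm_class_of (delete_set (E - A) D0)))
       * conv_power ?\<delta> k (basis (dm_class_of (contract_set A (loop_compl_set A D0)))))"
    by (simp add: conv_basis D0_def E_def)
  also have "\<dots> = (\<Sum>A\<in>Pow E. if card A = 1 then
      (if card E = Suc k then fact k * weight r s D0 E else 0) else 0)"
  proof (rule sum.cong[OF HOL.refl])
    fix A assume "A \<in> Pow E"
    then have A: "A \<subseteq> ground D0" by (simp add: E_def)
    note minors = vf_safe_minors[OF vf A]
    have cp: "conv_power ?\<delta> k (basis (dm_class_of (contract_set A (loop_compl_set A D0)))) =
      (if k = card (E - A) then fact k * weight r s (dual_pivot_set A D0) (E - A) else 0)"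
      using Suc.IH[OF minors(3)] by (simp add: minors weight_contract_set[OF vf A] E_def)
    have dl: "?\<delta> (basis (dm_class_of (delete_set (E - A) D0))) = (if card A = 1 then weight r s D0 A else 0)"
      using delta_hat_weight[OF minors(1), of r s] by (simp add: minors weight_delete_set[OF vf A] E_def)
    have w: "weight r s D0 E = weight r s D0 A * weight r s (dual_pivot_set A D0) (E - A)"
      using weight_Un[OF vf A, of "E - A"] A by (simp add: E_def Un_absorb1)
    \<comment> \<open>For \<open>card A = 1\<close> this makes the conditions
      \<open>k = card (E - A)\<close> and \<open>card E = Suc k\<close> equivalent.\<close>
    have "card E = card A + card (E - A)"
      using A fin by (metis E_def card_Diff_subset card_mono finite_subset le_add_diff_inverse)
    then show "?\<delta> (basis (dm_class_of (delete_set (E - A) D0)))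
       * conv_power ?\<delta> k (basis (dm_class_of (contract_set A (loop_compl_set A D0)))) =
      (if card A = 1 then (if card E = Suc k then fact k * weight r s D0 E else 0) else 0)"
      unfolding cp dl w by simp
  qed
  also have "\<dots> = of_nat (card {A \<in> Pow E. card A = 1})
      * (if card E = Suc k then fact k * weight r s D0 E else 0)"
    using fin by (simp flip: sum.inter_filter)
  also have "card {A \<in> Pow E. card A = 1} = card E"
    using n_subsets[OF fin, of 1] by simp
  also have "weight r s D0 E = weight r s D (ground D)"
    unfolding D0_def E_def by (rule weight_dm_rep(1)[OF Suc.prems])
  also have "card E = card (ground D)"
    unfolding D0_def E_def by (rule weight_dm_rep(2)[OF Suc.prems])
  finally show ?case by (cases "card (ground D) = Suc k") simp_all
qed

text \<open>Only the term with \<open>k\<close> equal to the degree survives, and its factorial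
  cancels the one in the series.\<close>

lemma exp_conv_delta_hat:
  fixes D :: "nat set_system" and r s :: "'k::field_char_0"
  assumes "vf_safe D"
  shows "exp_conv (delta_hat (r\<^sup>2, r * s, s\<^sup>2)) (basis (dm_class_of D)) = weight r s D (ground D)"
proof -
  have "exp_conv (delta_hat (r\<^sup>2, r * s, s\<^sup>2)) (basis (dm_class_of D)) =
    (\<Sum>k\<in>{card (ground D)}. conv_power (delta_hat (r\<^sup>2, r * s, s\<^sup>2)) k (basis (dm_class_of D)) / fact k)"
    unfolding exp_conv_def
    by (rule Sum_any.expand_superset) (auto simp: conv_power_delta_hat[OF assms])
  then show ?thesis by (simp add: conv_power_delta_hat[OF assms])
qed

text \<open>Convolution first gives a sum over subsets of the representative; an isomorphism
  \<open>f\<close> reindexes it by subsets of \<open>D\<close> itself, and the weights are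
  invariant.\<close>

lemma alpha_hat_basis:
  fixes D :: "'a set_system" and r s r' s' :: "'k::field_char_0"
  assumes "vf_safe D"
  shows "alpha_hat (r\<^sup>2, r * s, s\<^sup>2) (r'\<^sup>2, r' * s', s'\<^sup>2) (basis (dm_class_of D)) =
    (\<Sum>A\<in>Pow (ground D). weight r s D A * weight r' s' (dual_pivot_set A D) (ground D - A))"
proof -
  define D0 where "D0 = dm_rep (dm_class_of D)"
  have vf: "vf_safe D0" using dm_rep(2)[OF assms] by (simp add: D0_def)
  obtain f where f: "inj_on f (ground D)" "D0 = map_system f D"
    using dm_rep_map_system[OF assms] D0_def by metis
  have "alpha_hat (r\<^sup>2, r * s, s\<^sup>2) (r'\<^sup>2, r' * s', s'\<^sup>2) (basis (dm_class_of D)) =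
    (\<Sum>B\<in>Pow (ground D0). weight r s D0 B * weight r' s' (dual_pivot_set B D0) (ground D0 - B))"
    unfolding alpha_hat_def conv_basis D0_def[symmetric]
  proof (rule sum.cong[OF HOL.refl])
    fix B assume "B \<in> Pow (ground D0)"
    then have B: "B \<subseteq> ground D0" by simp
    note minors = vf_safe_minors[OF vf B]
    show "exp_conv (delta_hat (r\<^sup>2, r * s, s\<^sup>2)) (basis (dm_class_of (delete_set (ground D0 - B) D0)))
      * exp_conv (delta_hat (r'\<^sup>2, r' * s', s'\<^sup>2))
          (basis (dm_class_of (contract_set B (loop_compl_set B D0)))) =
      weight r s D0 B * weight r' s' (dual_pivot_set B D0) (ground D0 - B)"
      by (simp add: exp_conv_delta_hat minors weight_delete_set[OF vf B] weight_contract_set[OF vf B])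
  qed
  also have "\<dots> = (\<Sum>A\<in>Pow (ground D).
      weight r s D0 (f ` A) * weight r' s' (dual_pivot_set (f ` A) D0) (ground D0 - f ` A))"
    by (rule sum.reindex_bij_betw[OF bij_betw_Pow, symmetric])
      (simp add: bij_betw_def f)
  also have "\<dots> = (\<Sum>A\<in>Pow (ground D). weight r s D A * weight r' s' (dual_pivot_set A D) (ground D - A))"
  proof (rule sum.cong[OF HOL.refl])
    fix A assume "A \<in> Pow (ground D)"
    then have A: "A \<subseteq> ground D" by simp
    have fin: "finite A" using A vf_safeD(1)[OF assms] by (rule finite_subset)
    have pivot: "dual_pivot_set (f ` A) D0 = map_system f (dual_pivot_set A D)"
      using map_system_dual_pivot_set[OF fin f(1) vf_safe_well_formed[OF assms] A] f(2) by simp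
    have diff: "ground D0 - f ` A = f ` (ground D - A)"
      using inj_on_image_set_diff[OF f(1), of "ground D" A] A by (simp add: f(2))
    have "weight r' s' (map_system f (dual_pivot_set A D)) (f ` (ground D - A))
        = weight r' s' (dual_pivot_set A D) (ground D - A)"
      using vf_safe_dual_pivot_set[OF fin assms A] f(1) fin by (intro weight_map_system) auto
    then show "weight r s D0 (f ` A) * weight r' s' (dual_pivot_set (f ` A) D0) (ground D0 - f ` A) =
        weight r s D A * weight r' s' (dual_pivot_set A D) (ground D - A)"
      unfolding pivot diff using weight_map_system[OF assms f(1) A, of r s] f(2) by simp
  qed
  finally show ?thesis .
qed

text \<open>The restriction to natural exponents admits \<open>r = 0\<close>, as required when
  \<open>x2\<close> or \<open>y1\<close> vanishes.\<close>

lemma half_pow_square_nat: "half_pow (r\<^sup>2) r (of_nat m / 2) = r ^ m"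
proof (cases "even m")
  case True
  then obtain j where m: "m = 2 * j" by (elim evenE)
  then have "(of_nat m / 2 :: rat) = of_int (int j)" by simp
  then show ?thesis by (simp only: half_pow_def Ints_of_int floor_of_int if_True power_int_of_nat)
      (simp add: m power_mult)
next
  case False
  then obtain j where m: "m = 2 * j + 1" by (elim oddE)
  have fl: "\<lfloor>(of_nat m / 2 :: rat)\<rfloor> = int j"
    by (rule floor_unique) (simp_all add: m)
  have "(of_nat m / 2 :: rat) \<notin> \<int>"
  proof
    assume "(of_nat m / 2 :: rat) \<in> \<int>"
    then have "of_int \<lfloor>(of_nat m / 2 :: rat)\<rfloor> = (of_nat m / 2 :: rat)" by (elim Ints_cases) simp
    then show False unfolding fl by (simp add: m)
  qed
  then show ?thesis by (simp add: half_pow_def fl) (simp add: m power_mult)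
qed

text \<open>All four half-integer exponents are halves of sums of the exponents in the two weights,
  so both sides become the same monomial in the chosen square roots.\<close>

lemma P_tilde_dual_term:
  fixes sx1 sx2 sy1 sy2 :: "'k::field_char_0"
  assumes "vf_safe D" "A \<subseteq> ground D" "sx1 \<noteq> 0" "sy2 \<noteq> 0"
  shows "weight sx1 sx2 D A * weight sy1 sy2 (dual_pivot_set A D) (ground D - A) =
    half_pow (sx1\<^sup>2) sx1 (xi (dual D))
    * half_pow (sy2\<^sup>2) sy2 (of_nat (card (ground D)) - xi (dual D))
    * (half_pow (sy1\<^sup>2 / sx1\<^sup>2) (sy1 / sx1) (xi_on (dual D) (ground D) - xi_on (dual D) A)
      * half_pow (sx2\<^sup>2 / sy2\<^sup>2) (sx2 / sy2) (of_nat (card A) - xi_on (dual D) A))"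
proof -
  define B where "B = ground D - A"
  \<comment> \<open>\<open>p\<close> and \<open>q\<close> are the exponents in the weight of
    \<open>A\<close>; \<open>p'\<close> and \<open>q'\<close> are those for the complement after
    pivoting on \<open>A\<close>.\<close>
  define p q where "p = nat (int (card A) + pivot_drop D A)" "q = nat (int (card A) - pivot_drop D A)"
  define p' q' where "p' = nat (int (card B) + pivot_drop (dual_pivot_set A D) B)"
    "q' = nat (int (card B) - pivot_drop (dual_pivot_set A D) B)"
  have fin: "finite A" "finite B" using assms by (auto intro: finite_subset dest: vf_safeD(1) simp: B_def)
  have E: "ground D = A \<union> B" "A \<inter> B = {}" using assms(2) by (auto simp: B_def)
  have "\<bar>pivot_drop D A\<bar> \<le> int (card A)" "\<bar>pivot_drop (dual_pivot_set A D) B\<bar> \<le> int (card B)"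
    using assms fin by (auto intro!: abs_pivot_drop_le vf_safe_dual_pivot_set simp: B_def)
  then have pq: "int p = int (card A) + pivot_drop D A" "int q = int (card A) - pivot_drop D A"
    "int p' = int (card B) + pivot_drop (dual_pivot_set A D) B" "int q' = int (card B) - pivot_drop (dual_pivot_set A D) B"
    by (simp_all add: p_q_def p'_q'_def)
  have card: "card (ground D) = card A + card B"
    using fin E by (simp add: card_Un_disjoint)
  have "int (card (ground D)) + pivot_drop D (ground D) = int (p + p')"
    using pivot_drop_Un[OF fin E(2), of D] by (simp add: card pq E(1)[symmetric])
  then have xiE: "xi_on (dual D) (ground D) = of_nat (p + p') / 2"
    using xi_on_dual[OF assms(1), of "ground D"] by simp
  have xiA: "xi_on (dual D) A = of_nat p / 2"
    using xi_on_dual[OF assms(1,2)] by (simp add: pq(1)[symmetric])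
  have half_sum: "(of_nat m :: rat) = (of_nat i + of_nat j) / 2" if "2 * m = i + j" for m i j :: nat
  proof -
    have "2 * of_nat m = (of_nat (i + j) :: rat)" unfolding that[symmetric] by simp
    then show ?thesis by simp
  qed
  \<comment> \<open>The drop enters the two exponents with opposite signs, so it cancels from their
    mean.\<close>
  have cA: "(of_nat (card A) :: rat) = (of_nat p + of_nat q) / 2"
    and cB: "(of_nat (card B) :: rat) = (of_nat p' + of_nat q') / 2"
    by (rule half_sum; use pq in linarith)+
  have h1: "xi (dual D) = of_nat (p + p') / 2" by (simp add: xi_def xiE)
  have h2: "of_nat (card (ground D)) - xi (dual D) = of_nat (q + q') / 2"
    by (simp add: h1 card cA cB field_simps)
  have h3: "xi_on (dual D) (ground D) - xi_on (dual D) A = of_nat p' / 2"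
    by (simp add: xiE xiA field_simps)
  have h4: "of_nat (card A) - xi_on (dual D) A = of_nat q / 2"
    by (simp add: cA xiA field_simps)
  have "weight sx1 sx2 D A * weight sy1 sy2 (dual_pivot_set A D) (ground D - A) =
      sx1 ^ p * sx2 ^ q * (sy1 ^ p' * sy2 ^ q')"
    by (simp add: weight_def p_q_def p'_q'_def B_def)
  \<comment> \<open>Here \<open>sx1 ^ p'\<close> and \<open>sy2 ^ q\<close> are supplied and divided
    out again, which is where \<open>sx1\<close> and \<open>sy2\<close> must be nonzero.\<close>
  also have "\<dots> = sx1 ^ (p + p') * sy2 ^ (q + q') * ((sy1 / sx1) ^ p' * (sx2 / sy2) ^ q)"
    using assms(3,4) by (simp add: power_add field_simps)
  finally show ?thesis
    unfolding h2 h3 h4 unfolding h1 power_divide[symmetric] half_pow_square_nat .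
qed

text \<open>One square root of each variable is fixed and all other roots are derived from these:
  that of \<open>x1 * x2\<close> is \<open>sx1 * sx2\<close>, that of \<open>y1 / x1\<close> is
  \<open>sy1 / sx1\<close>, and so on. This makes the half-integer powers on both sides
  consistent.\<close>

theorem theorem4p11:
  fixes D :: "'a set_system"
    and x1 x2 y1 y2 sx1 sx2 sy1 sy2 :: "'k::field_char_0"
  assumes "vf_safe D"
    and "sx1 ^ 2 = x1" and "sx2 ^ 2 = x2" and "sy1 ^ 2 = y1" and "sy2 ^ 2 = y2"
    and "x1 \<noteq> 0" and "y2 \<noteq> 0"
  shows "alpha_hat (x1, sx1 * sx2, x2) (y1, sy1 * sy2, y2) (basis (dm_class_of D)) =
    half_pow x1 sx1 (xi (dual D))
    * half_pow y2 sy2 (of_nat (card (ground D)) - xi (dual D))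
    * P_tilde (dual D) (y1 / x1 + 1) (x2 / y2 + 1) (sy1 / sx1) (sx2 / sy2)"
proof -
  have nz: "sx1 \<noteq> 0" "sy2 \<noteq> 0" using assms by auto
  have P: "P_tilde (dual D) (y1 / x1 + 1) (x2 / y2 + 1) (sy1 / sx1) (sx2 / sy2) =
    (\<Sum>A\<in>Pow (ground D).
       half_pow (sy1\<^sup>2 / sx1\<^sup>2) (sy1 / sx1) (xi_on (dual D) (ground D) - xi_on (dual D) A)
      * half_pow (sx2\<^sup>2 / sy2\<^sup>2) (sx2 / sy2) (of_nat (card A) - xi_on (dual D) A))"
    by (simp add: P_tilde_def assms)
  \<comment> \<open>The prefactors are moved inside the sum, so that both sides can be compared
    subset by subset.\<close>
  show ?thesis
    unfolding P sum_distrib_left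
    unfolding assms(2-5)[symmetric] alpha_hat_basis[OF assms(1)]
    by (rule sum.cong[OF HOL.refl]) (simp only: P_tilde_dual_term[OF assms(1) _ nz] Pow_iff)
qed

end
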